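(* Let $X_1,\dots,X_n$ be i.i.d. random variables with common distribution $P$ and let $\delta>0$ be such that $\lceil\ln(\delta^{-2})\rceil\le n/2$. Let $V=\lceil\ln(\delta^{-2})\rceil\vee8$, assume $V\le n/2$, and let $\mathcal B=(B_1,\dots,B_V)$ be a regular partition of $\{1,\dots,n\}$. Let $\hat s_1,\dots,\hat s_V$ be $S$-valued estimators, $\hat s_K=F(X_{B_K})$, satisfying the following margin condition: there exist $N\in\mathbb N$, $\alpha_1,\dots,\alpha_N\in[0,1)$, finite $\sigma_0^2,\dots,\sigma_N^2\ge 0$, $\epsilon\le1$ and an event $\Omega_\epsilon$ with $\mathbb P(\Omega_\epsilon)\ge1-\epsilon$ such that on $\Omega_\epsilon$, for all $K=1,\dots,V$, $$\mathrm{var}\left[(\gamma(\hat s_K)-\gamma(s_o))(X)\,\middle|\,X_{B_K}\right]\le\sigma_0^2\,\ell(\hat s_K,s_o)^2+\sum_{i=1}^N\sigma_i^2\,\ell(\hat s_K,s_o)^{2\alpha_i},$$ where $X$ has distribution $P$ and is independent of $X_1,\dots,X_n$. Let $\hat s_{K_\star}$ be the associated estimator, where $$K_\star\in\arg\min_{K=1,\dots,V}\ \max_{K'=1,\dots,V}\left\{\overline P_{K,K'}\left(\gamma(\hat s_K)-\gamma(\hat s_{K'})\right)\right\}.$$ Let $C_0=L_1$ and, for $i=1,\dots,N$, $C_i=4(1-\alpha_i)\left(L_1\alpha_i^{\alpha_i}\right)^{1/(1-\alpha_i)}$ (with $0^0=1$). For all $\Delta>1$ let $$\nu_n(\Delta)=C_0\sigma_0\sqrt{\frac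 Vn}+\frac N\Delta,\qquad R_n(\Delta)=\sum_{i=1}^NC_i\left(\Delta^{\alpha_i}\sigma_i\sqrt{\frac Vn}\right)^{\frac1{1-\alpha_i}}.$$ Then, for all $\Delta>1$, with probability larger than $1-\delta-\epsilon$, $$(1-\nu_n(\Delta))\,\ell(\hat s_{K_\star},s_o)\le(1+3\nu_n(\Delta))\inf_K\{\ell(\hat s_K,s_o)\}+R_n(\Delta).$$ In particular, for all $\Delta,n$ such that $\nu_n(\Delta)\le1/2$, with probability larger than $1-\epsilon-\delta$, $$\ell(\hat s_{K_\star},s_\star)\le\ell(s_o,s_\star)+(1+8\nu_n(\Delta))\inf_K\{\ell(\hat s_K,s_o)\}+2R_n(\Delta).$$
   Context: Let $\mathcal T$ be a set (of candidate parameters) and let the contrast $\gamma$ associate to each $t\in\mathcal T$ a $P$-integrable measurable function $\gamma(t)$ on the observation space. $Pf=\mathbb E[f(X)]$ for $X\sim P$. The target is $s_\star\in\arg\min_{t\in\mathcal T}P\gamma(t)$; $S\subset\mathcal T$ and $s_o\in\arg\min_{t\in S}P\gamma(t)$. For $t,u\in\mathcal T$, $\ell(t,u)=P(\gamma(t)-\gamma(u))$ (for a data-dependent $t=\hat s$, $P$ integrates only with respect to the independent variable $X$). $X_{B_K}=(X_i)_{i\in B_K}$. A partition $(B_1,\dots,B_V)$ of $\{1,\dots,n\}$ is regular if $|\mathrm{Card}(B_K)-n/V|\le1$ for all $K$. $P_{B_J}t=\frac1{\mathrm{Card}(B_J)}\sum_{i\in B_J}t(X_i)$ and $\overline P_{K,K'}t=\mathrm{Med}\{P_{B_J}t:\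 J\ne K,K'\}$, where $\mathrm{Med}(a_1,\dots,a_N)$ is any real $b$ with $\mathrm{Card}\{i: a_i\le b\}\ge N/2$ and $\mathrm{Card}\{i:a_i\ge b\}\ge N/2$. $L_1=\sqrt{2/r}$ with $r=(1-\sqrt{1-e^{-2}})/2$ (so $L_1\le2\sqrt{6e}$). $a\vee b=\max(a,b)$. *)

theory Defs
  imports "HOL-Probability.Probability"
begin

text \<open>Throughout, \<open>P\<close> is the common distribution of the observations, regarded as a measure on
  the observation space, and \<open>\<gamma> t\<close> is the contrast function of the parameter \<open>t\<close>.\<close>

definition excess_loss :: "'x measure \<Rightarrow> ('t \<Rightarrow> 'x \<Rightarrow> real) \<Rightarrow> 't \<Rightarrow> 't \<Rightarrow> real" where
  "excess_loss P \<gamma> t u = (\<integral>x. \<gamma> t x - \<gamma> u x \<partial>P)"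

text \<open>The variance takes values in \<open>[0, \<infinity>]\<close>: the Bochner integral would assign variance \<open>0\<close> to an
  integrable function that is not square-integrable, and a bound on it would then be vacuous.\<close>

definition ext_variance :: "'x measure \<Rightarrow> ('x \<Rightarrow> real) \<Rightarrow> ennreal" where
  "ext_variance P f = (\<integral>\<^sup>+x. ennreal ((f x - (\<integral>y. f y \<partial>P))\<^sup>2) \<partial>P)"

definition regular_partition :: "nat \<Rightarrow> nat \<Rightarrow> (nat \<Rightarrow> nat set) \<Rightarrow> bool" where
  "regular_partition n V B \<longleftrightarrow>
     disjoint_family_on B {1..V} \<and> (\<Union>K\<in>{1..V}. B K) = {1..n} \<and>
     (\<forall>K\<in>{1..V}. B K \<noteq> {} \<and> \<bar>real (card (B K)) - real n / real V\<bar> \<le> 1)"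

definition block_mean :: "(nat \<Rightarrow> 'x) \<Rightarrow> nat set \<Rightarrow> ('x \<Rightarrow> real) \<Rightarrow> real" where
  "block_mean x A f = (\<Sum>i\<in>A. f (x i)) / real (card A)"

text \<open>Medians need not be unique, hence a predicate rather than a function.\<close>

definition is_median :: "'i set \<Rightarrow> ('i \<Rightarrow> real) \<Rightarrow> real \<Rightarrow> bool" where
  "is_median I a b \<longleftrightarrow>
     real (card {i\<in>I. a i \<le> b}) \<ge> real (card I) / 2 \<and>
     real (card {i\<in>I. a i \<ge> b}) \<ge> real (card I) / 2"

text \<open>Real powers with \<open>0\<^sup>0 = 1\<close>; in contrast, \<open>0 powr 0 = 0\<close>.\<close>

definition rpow :: "real \<Rightarrow> real \<Rightarrow> real" where
  "rpow x a = (if a = 0 then 1 else x powr a)"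

definition L1 :: real where
  "L1 = sqrt (2 / ((1 - sqrt (1 - exp (-2))) / 2))"

definition C_const :: "real \<Rightarrow> real" where
  "C_const a = 4 * (1 - a) * (L1 * rpow a a) powr (1 / (1 - a))"

definition nu :: "nat \<Rightarrow> (nat \<Rightarrow> real) \<Rightarrow> nat \<Rightarrow> nat \<Rightarrow> real \<Rightarrow> real" where
  "nu N \<sigma> V n \<Delta> = L1 * \<sigma> 0 * sqrt (real V / real n) + real N / \<Delta>"

definition remainder ::
  "nat \<Rightarrow> (nat \<Rightarrow> real) \<Rightarrow> (nat \<Rightarrow> real) \<Rightarrow> nat \<Rightarrow> nat \<Rightarrow> real \<Rightarrow> real" where
  "remainder N \<alpha> \<sigma> V n \<Delta> =
     (\<Sum>i=1..N. C_const (\<alpha> i) *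
        (\<Delta> powr \<alpha> i * \<sigma> i * sqrt (real V / real n)) powr (1 / (1 - \<alpha> i)))"

text \<open>The set of all \<open>\<omega>\<close> with \<open>Q \<omega>\<close> need not be measurable (arbitrary choices of medians and of
  minimisers may enter \<open>Q\<close>), so it is required to contain an event of the stated probability. For
  measurable \<open>Q\<close> this says that the probability of \<open>Q\<close> is at least \<open>p\<close>.\<close>

definition with_prob_at_least :: "'w measure \<Rightarrow> real \<Rightarrow> ('w \<Rightarrow> bool) \<Rightarrow> bool" where
  "with_prob_at_least M p Q \<longleftrightarrow> (\<exists>E\<in>sets M. measure M E \<ge> p \<and> (\<forall>\<omega>\<in>E. Q \<omega>))"

end

theory Submission
  imports Defs
begin

text \<open>Conditionally on two blocks \<open>K \<noteq> K'\<close>, Chebyshev's inequality bounds the probability \<open>p J\<close> that the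
  mean of block \<open>J\<close> of the contrast difference misses its expectation by more than \<open>L1 * sqrt (V / n)\<close>
  standard deviations, and \<open>\<Sum>J. p J \<le> 2 r V / 3\<close>. The median over the remaining blocks can only miss
  by more if at least \<open>k = (V - 1) div 2\<close> of them do. Summing over the unordered pairs \<open>{K, K'}\<close> and
  the sets of \<open>k\<close> other blocks bounds the probability of a bad pair by
  \<open>(V - k choose 2) * (2 r V / 3) ^ k / fact k \<le> exp (- V / 2) \<le> \<delta>\<close>; bounding each pair separately would
  give the factor \<open>V choose 2\<close> instead, which is too large for \<open>V = 8\<close>.

  Outside the bad event, the margin condition and Young's inequality turn the standard deviations
  into \<open>\<nu> * \<ell> + R / 4\<close>. Comparing the selected block with the best one, and the best one with all
  others, gives the first claim; the second is a rearrangement.\<close>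

section \<open>Elementary symmetric sums over pairs and subsets\<close>

text \<open>In the expansion of the \<open>k\<close>-th power every squarefree monomial occurs
  \<open>fact k\<close> times, and the remaining terms are nonnegative. The induction avoids the
  multinomial theorem: adding \<open>a\<close> to \<open>S\<close> adds to the sum
  \<open>p a\<close> times the corresponding sum for \<open>k - 1\<close>.\<close>

lemma sum_prod_subsets_le:
  fixes p :: "'a \<Rightarrow> real"
  assumes "finite S" and "\<And>x. x \<in> S \<Longrightarrow> 0 \<le> p x"
  shows "(\<Sum>A | A \<subseteq> S \<and> card A = k. \<Prod>x\<in>A. p x) \<le> (\<Sum>x\<in>S. p x) ^ k / fact k"
  using assms
proof (induction S arbitrary: k rule: finite_induct)
  case empty
  show ?case
  proof (cases k)
    case 0
    have "{A :: 'a set. A \<subseteq> {} \<and> card A = 0} = {{}}" by auto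
    then show ?thesis unfolding 0 by simp
  next
    case (Suc j)
    have "{A :: 'a set. A \<subseteq> {} \<and> card A = Suc j} = {}" by auto
    then show ?thesis unfolding Suc by simp
  qed
next
  case (insert a S)
  have p: "0 \<le> p a" "\<And>x. x \<in> S \<Longrightarrow> 0 \<le> p x" and IH: "\<And>k. (\<Sum>A | A \<subseteq> S \<and> card A = k. \<Prod>x\<in>A. p x) \<le> (\<Sum>x\<in>S. p x) ^ k / fact k"
    using insert by auto
  define s where "s = (\<Sum>x\<in>S. p x)"
  have s: "0 \<le> s" unfolding s_def using p by (intro sum_nonneg) auto
  show ?case
  proof (cases k)
    case 0
    have "{A. A \<subseteq> insert a S \<and> card A = 0} = {{}}"
      using insert(1) by (auto simp: card_eq_0_iff dest: finite_subset)
    then show ?thesis unfolding 0 by simp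
  next
    case (Suc j)
    have fin: "finite {A. A \<subseteq> S \<and> card A = i}" for i using insert(1) by simp
    have split: "{A. A \<subseteq> insert a S \<and> card A = k}
      = {A. A \<subseteq> S \<and> card A = k} \<union> insert a ` {A. A \<subseteq> S \<and> card A = j}" (is "?L = ?M \<union> ?N")
    proof (intro equalityI subsetI)
      fix A assume A: "A \<in> ?L"
      then have fA: "finite A" using insert(1) finite_subset[of A "insert a S"] by simp
      show "A \<in> ?M \<union> ?N"
      proof (cases "a \<in> A")
        case True
        then have "A = insert a (A - {a})" "A - {a} \<subseteq> S" "card (A - {a}) = j"
          using A fA Suc by auto
        then show ?thesis by blast
      qed (use A in auto)
    next
      fix A assume "A \<in> ?M \<union> ?N"
      then show "A \<in> ?L"
        using insert(1,2) Suc finite_subset[OF _ insert(1)] by (auto simp: card_insert_if)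
    qed
    have disj: "?M \<inter> ?N = {}" using insert(2) by auto
    have inj: "inj_on (insert a) {A. A \<subseteq> S \<and> card A = j}"
      using insert(2) by (auto simp: inj_on_def)
    have ins: "(\<Prod>x\<in>insert a A. p x) = p a * (\<Prod>x\<in>A. p x)" if "A \<subseteq> S" for A
      using that insert(1,2) by (subst prod.insert) (auto dest: finite_subset)
    have "(\<Sum>A\<in>?L. \<Prod>x\<in>A. p x)
        = (\<Sum>A\<in>?M. \<Prod>x\<in>A. p x) + p a * (\<Sum>A | A \<subseteq> S \<and> card A = j. \<Prod>x\<in>A. p x)"
    proof -
      have "(\<Sum>A\<in>?N. \<Prod>x\<in>A. p x) = (\<Sum>A | A \<subseteq> S \<and> card A = j. \<Prod>x\<in>insert a A. p x)"
        by (rule sum.reindex[OF inj, unfolded o_def])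
      also have "\<dots> = p a * (\<Sum>A | A \<subseteq> S \<and> card A = j. \<Prod>x\<in>A. p x)"
        unfolding sum_distrib_left by (intro sum.cong) (simp_all add: ins)
      finally show ?thesis
        unfolding split using fin[of j] sum.union_disjoint[OF fin[of k] _ disj, of "prod p"] by simp
    qed
    also have "\<dots> \<le> s ^ k / fact k + p a * (s ^ j / fact j)"
      unfolding s_def using IH p by (intro add_mono mult_left_mono) auto
    also have "\<dots> = (s ^ k + real k * s ^ j * p a) / fact k"
      by (simp add: Suc add_divide_distrib mult_ac del: of_nat_Suc)
    \<comment> \<open>These are the first two terms of the binomial expansion; the others are
      nonnegative.\<close>
    also have "s ^ k + real k * s ^ j * p a \<le> (s + p a) ^ k"
      unfolding Suc
    proof (induction j)
      case (Suc i)
      have "s ^ Suc (Suc i) + real (Suc (Suc i)) * s ^ Suc i * p a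
          \<le> (s ^ Suc i + real (Suc i) * s ^ i * p a) * (s + p a)"
        using s p by (simp add: algebra_simps)
      also have "\<dots> \<le> (s + p a) ^ Suc i * (s + p a)"
        using Suc s p by (intro mult_right_mono) auto
      finally show ?case by (simp add: mult_ac)
    qed auto
    finally show ?thesis
      using insert(1,2) by (simp add: s_def add.commute divide_right_mono)
  qed
qed

text \<open>Exchanging the two sums counts, for each \<open>k\<close>-subset \<open>A\<close>, the
  pairs disjoint from it. This is where the factor is reduced from all pairs in \<open>I\<close> to
  the pairs in \<open>I - A\<close>.\<close>

lemma sum_pairs_prod_subsets_le:
  fixes p :: "'a \<Rightarrow> real"
  assumes "finite I" and "\<And>x. x \<in> I \<Longrightarrow> 0 \<le> p x"
  shows "(\<Sum>D | D \<subseteq> I \<and> card D = 2. \<Sum>A | A \<subseteq> I - D \<and> card A = k. \<Prod>x\<in>A. p x)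
    \<le> real ((card I - k) choose 2) * ((\<Sum>x\<in>I. p x) ^ k / fact k)"
proof -
  let ?P = "{D. D \<subseteq> I \<and> card D = 2}" and ?K = "{A. A \<subseteq> I \<and> card A = k}"
  have eq1: "{A. A \<subseteq> I - D \<and> card A = k} = {A \<in> ?K. A \<inter> D = {}}" for D by auto
  have eq2: "{D \<in> ?P. A \<inter> D = {}} = {D. D \<subseteq> I - A \<and> card D = 2}" for A by auto
  have "(\<Sum>D\<in>?P. \<Sum>A | A \<subseteq> I - D \<and> card A = k. \<Prod>x\<in>A. p x)
      = (\<Sum>A\<in>?K. \<Sum>D\<in>{D \<in> ?P. A \<inter> D = {}}. \<Prod>x\<in>A. p x)"
    unfolding eq1 using assms(1) by (intro sum.swap_restrict) auto
  also have "\<dots> = (\<Sum>A\<in>?K. real ((card I - k) choose 2) * (\<Prod>x\<in>A. p x))"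
  proof (rule sum.cong[OF refl])
    fix A assume "A \<in> ?K"
    then have "card (I - A) = card I - k"
      using assms(1) finite_subset[of A I] by (simp add: card_Diff_subset)
    then show "(\<Sum>D\<in>{D \<in> ?P. A \<inter> D = {}}. \<Prod>x\<in>A. p x)
        = real ((card I - k) choose 2) * (\<Prod>x\<in>A. p x)"
      unfolding eq2 using assms(1) by (simp add: n_subsets)
  qed
  also have "\<dots> \<le> real ((card I - k) choose 2) * ((\<Sum>x\<in>I. p x) ^ k / fact k)"
    unfolding sum_distrib_left[symmetric] using assms
    by (intro mult_left_mono sum_prod_subsets_le) auto
  finally show ?thesis .
qed

section \<open>Block sizes and numerical constants\<close>

text \<open>By convexity \<open>1 / c\<close> lies below its chord over the interval from
  \<open>m - 1\<close> to \<open>m + 1\<close>. The chord is affine in \<open>c\<close>, so its sum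
  over the blocks depends only on their total size.\<close>

lemma inverse_le_secant:
  fixes c m :: real
  assumes "1 < m" "0 < c" "\<bar>c - m\<bar> \<le> 1"
  shows "1 / c \<le> (2 * m - c) / (m\<^sup>2 - 1)"
proof -
  have "0 \<le> (c - (m - 1)) * ((m + 1) - c)" using assms by (intro mult_nonneg_nonneg) auto
  then have "m\<^sup>2 - 1 \<le> c * (2 * m - c)" by (simp add: algebra_simps power2_eq_square)
  moreover have "1 < m\<^sup>2" using assms by (simp add: one_less_power)
  ultimately show ?thesis using assms by (simp add: field_simps)
qed

text \<open>A single block may have only \<open>m - 1\<close> elements, which costs a factor \<open>m / (m - 1) \<le> 2\<close> in Chebyshev's
  inequality. On average over the blocks the loss is smaller, and the improvement is needed for the
  union bound with eight blocks.\<close>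

lemma sum_inverse_block_size_le:
  fixes c :: "'i \<Rightarrow> real"
  assumes "finite I" "I \<noteq> {}" and m: "2 \<le> m" and "\<And>J. J \<in> I \<Longrightarrow> 0 < c J \<and> \<bar>c J - m\<bar> \<le> 1"
    and "(\<Sum>J\<in>I. c J) = real (card I) * m"
  shows "(\<Sum>J\<in>I. m / (2 * c J)) \<le> 2 / 3 * real (card I)"
proof -
  have m1: "1 < m\<^sup>2" using m by (simp add: one_less_power)
  have "(\<Sum>J\<in>I. m / (2 * c J)) = (m / 2) * (\<Sum>J\<in>I. 1 / c J)"
    by (simp add: sum_distrib_left)
  also have "(\<Sum>J\<in>I. 1 / c J) \<le> (\<Sum>J\<in>I. (2 * m - c J) / (m\<^sup>2 - 1))"
    using assms by (intro sum_mono inverse_le_secant) auto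
  also have "\<dots> = real (card I) * (m / (m\<^sup>2 - 1))"
    using assms by (simp add: sum_divide_distrib[symmetric] sum_subtractf algebra_simps)
  also have "m / 2 * (real (card I) * (m / (m\<^sup>2 - 1))) = real (card I) * (m\<^sup>2 / (2 * (m\<^sup>2 - 1)))"
    by (simp add: power2_eq_square)
  \<comment> \<open>The quotient decreases in \<open>m\<close>, and its value at
    \<open>m = 2\<close> is \<open>4 / 6\<close>.\<close>
  also have "\<dots> \<le> real (card I) * (2 / 3)"
  proof (intro mult_left_mono)
    have "2\<^sup>2 \<le> m\<^sup>2" using m by (intro power_mono) auto
    then show "m\<^sup>2 / (2 * (m\<^sup>2 - 1)) \<le> 2 / 3" using m1 by (simp add: field_simps)
  qed auto
  finally show ?thesis using m by (simp add: mult.commute mult_left_mono)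
qed

text \<open>The number \<open>r\<close> with \<open>L1 = sqrt (2 / r)\<close>. For a block of
  exactly \<open>n / V\<close> elements, Chebyshev's inequality at \<open>L1 * sqrt (V / n)\<close>
  standard deviations gives the failure probability \<open>r / 2\<close>.\<close>

definition r_const :: real where "r_const = (1 - sqrt (1 - exp (-2))) / 2"

lemma r_const_pos: "0 < r_const" and r_const_le: "r_const \<le> 1 / 25"
proof -
  show "0 < r_const" by (simp add: r_const_def real_sqrt_less_iff[where y=1, simplified])
  have "(2.7::real)\<^sup>2 \<le> exp 1 ^ 2" using e_approx_32 by (intro power_mono) (auto simp: abs_if split: if_splits)
  then have "(7.29::real) \<le> exp 2" by (simp add: exp_of_nat_mult[symmetric] power2_eq_square exp_add[symmetric])
  then have "exp (-2::real) \<le> 1 / 7.29" unfolding exp_minus by (simp add: field_simps)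
  then have "(0.92::real)\<^sup>2 \<le> 1 - exp (-2)" by (simp add: power2_eq_square)
  then have "0.92 \<le> sqrt (1 - exp (-2::real))" by (rule real_le_rsqrt)
  then show "r_const \<le> 1 / 25" unfolding r_const_def by simp
qed

lemma L1_sqr: "L1\<^sup>2 = 2 / r_const" and L1_pos: "0 < L1"
  using r_const_pos unfolding L1_def r_const_def[symmetric] by auto

lemma exp_one_less: "exp 1 < (2.72::real)"
  using e_approx_32 by (auto simp: abs_if split: if_splits)

text \<open>The constant \<open>2 / 75\<close> is \<open>2 / 3\<close> times the upper bound \<open>1 / 25\<close> for \<open>r_const\<close>.\<close>

lemma union_bound_numeric:
  assumes "3 \<le> k"
  shows "real ((k + 2) choose 2) * ((2 * (real k + 1) * (2 / 75)) ^ k / fact k) \<le> exp (- (real k + 1))"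
  using assms
proof (induction k rule: dec_induct)
  \<comment> \<open>This is the case of eight blocks and the tightest one: the left-hand side is
    about 0.0162, while \<open>exp (- 4)\<close> is about 0.0183.\<close>
  case base
  have "(exp 1 :: real) ^ 4 \<le> 2.72 ^ 4" using exp_one_less by (intro power_mono) auto
  then have "exp (4::real) \<le> 2.72 ^ 4" by (simp add: exp_of_nat_mult[symmetric])
  then have "1 / 2.72 ^ 4 \<le> exp (-4::real)" unfolding exp_minus by (simp add: field_simps)
  then show ?case by (simp add: eval_nat_numeral choose_two)
next
  case (step k)
  let ?x = "real k + 1"
  let ?f = "real ((k + 2) choose 2) * ((2 * ?x * (2 / 75)) ^ k / fact k)"
  have ch: "real ((m + 2) choose 2) = (real m + 2) * (real m + 1) / 2" for m
  proof -
    have "even ((m + 2) * (m + 1))" by simp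
    then show ?thesis unfolding choose_two by (auto simp: real_of_nat_div algebra_simps)
  qed
  \<comment> \<open>The base of the power also grows with \<open>k\<close>; this bounds its
    contribution to the ratio of consecutive terms by \<open>exp 1\<close>.\<close>
  have "(1 + 1 / ?x) ^ k \<le> exp (1 / ?x) ^ k" by (intro power_mono exp_ge_add_one_self) auto
  also have "\<dots> = exp (real k * (1 / ?x))" by (rule exp_of_nat_mult[symmetric])
  also have "\<dots> \<le> exp 1" by (simp add: field_simps)
  finally have e: "(1 + 1 / ?x) ^ k \<le> exp 1" .
  have x1: "2 * (?x + 1) * (2 / 75) = (2 * ?x * (2 / 75)) * (1 + 1 / ?x)"
    by (simp add: field_simps)
  have pw: "(2 * (?x + 1) * (2 / 75)) ^ k = (2 * ?x * (2 / 75)) ^ k * (1 + 1 / ?x) ^ k"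
    unfolding x1 by (rule power_mult_distrib)
  have "real ((Suc k + 2) choose 2) * ((2 * (real (Suc k) + 1) * (2 / 75)) ^ Suc k / fact (Suc k))
     = (?x + 2) * (?x + 1) / 2 * ((2 * (?x + 1) * (2 / 75)) * (2 * (?x + 1) * (2 / 75)) ^ k / (?x * fact k))"
    unfolding ch by (simp add: algebra_simps)
  also have "\<dots> = ?f * ((?x + 2) / ?x * (2 * (?x + 1) * (2 / 75) / ?x) * (1 + 1 / ?x) ^ k)"
  proof -
    have *: "(x + 2) * (x + 1) / 2 * (c * (y * w) / (x * z))
        = (x + 1) * x / 2 * (y / z) * ((x + 2) / x * (c / x) * w)" if "x > 0" for x c y w z :: real
      using that by (cases "z = 0") (simp_all add: field_simps)
    have ch': "real ((k + 2) choose 2) = (?x + 1) * ?x / 2" unfolding ch by simp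
    show ?thesis unfolding pw ch' by (rule *) simp
  qed
  \<comment> \<open>Since \<open>?x\<close> is at least 4, the first two factors of the ratio are at
    most \<open>3 / 2\<close> and \<open>1 / 15\<close>. The ratio is then at most
    \<open>exp 1 / 10\<close>, which is below \<open>exp (- 1)\<close> because \<open>exp 2\<close>
    is less than 10.\<close>
  also have "\<dots> \<le> exp (- ?x) * (3 / 2 * (1 / 15) * exp 1)"
    using step e by (intro mult_mono) (auto simp: field_simps)
  also have "\<dots> \<le> exp (- ?x) * exp (-1)"
  proof (intro mult_left_mono)
    have "exp 1 * exp 1 \<le> (2.72::real) * 2.72" using exp_one_less by (intro mult_mono) auto
    then show "3 / 2 * (1 / 15) * exp 1 \<le> exp (-1 :: real)"
      by (simp add: exp_minus field_simps)
  qed auto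
  also have "\<dots> = exp (- (real (Suc k) + 1))" by (simp add: exp_add[symmetric])
  finally show ?case .
qed

section \<open>Chebyshev's inequality for one block\<close>

text \<open>Variances of independent centred variables add up. Integrating out one coordinate at a
  time, the cross term vanishes because \<open>f\<close> has mean zero.\<close>

lemma nn_integral_PiM_sum_sqr:
  fixes f :: "'x \<Rightarrow> real"
  assumes P: "prob_space P" and f: "integrable P f" "(\<integral>x. f x \<partial>P) = 0"
    and f2: "integrable P (\<lambda>x. (f x)\<^sup>2)" and "finite I"
  shows "(\<integral>\<^sup>+y. ennreal ((\<Sum>i\<in>I. f (y i))\<^sup>2) \<partial>(Pi\<^sub>M I (\<lambda>_. P)))
    = ennreal (real (card I) * (\<integral>x. (f x)\<^sup>2 \<partial>P))"
  using \<open>finite I\<close>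
proof (induction I rule: finite_induct)
  case empty
  show ?case by simp
next
  case (insert j I)
  interpret p: prob_space P by fact
  interpret product_prob_space "\<lambda>_. P" I by standard
  have [measurable]: "f \<in> borel_measurable P" using f by auto
  have inner: "(\<integral>\<^sup>+x. ennreal ((a + f x)\<^sup>2) \<partial>P) = ennreal (a\<^sup>2) + ennreal (\<integral>x. (f x)\<^sup>2 \<partial>P)" for a
  proof -
    have exp: "(a + f x)\<^sup>2 = a\<^sup>2 + 2 * a * f x + (f x)\<^sup>2" for x by (simp add: power2_sum)
    have "integrable P (\<lambda>x. (a + f x)\<^sup>2)" unfolding exp using f f2 by auto
    then have "(\<integral>\<^sup>+x. ennreal ((a + f x)\<^sup>2) \<partial>P) = ennreal (\<integral>x. (a + f x)\<^sup>2 \<partial>P)"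
      by (rule nn_integral_eq_integral) simp
    also have "(\<integral>x. (a + f x)\<^sup>2 \<partial>P) = a\<^sup>2 + (\<integral>x. (f x)\<^sup>2 \<partial>P)"
      unfolding exp using f f2 by (simp add: p.prob_space)
    finally show ?thesis by simp
  qed
  have upd: "(\<Sum>i\<in>insert j I. f ((x(j := y)) i)) = (\<Sum>i\<in>I. f (x i)) + f y" for x y
    using insert by (simp, intro arg_cong2[where f="(+)"] refl sum.cong) auto
  have "(\<integral>\<^sup>+y. ennreal ((\<Sum>i\<in>insert j I. f (y i))\<^sup>2) \<partial>(Pi\<^sub>M (insert j I) (\<lambda>_. P)))
    = (\<integral>\<^sup>+x. (\<integral>\<^sup>+y. ennreal ((\<Sum>i\<in>insert j I. f ((x(j := y)) i))\<^sup>2) \<partial>P) \<partial>(Pi\<^sub>M I (\<lambda>_. P)))"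
    using insert by (intro product_nn_integral_insert) auto
  also have "\<dots> = (\<integral>\<^sup>+x. ennreal ((\<Sum>i\<in>I. f (x i))\<^sup>2) + ennreal (\<integral>x. (f x)\<^sup>2 \<partial>P) \<partial>(Pi\<^sub>M I (\<lambda>_. P)))"
    unfolding upd inner ..
  also have "\<dots> = ennreal (real (card I) * (\<integral>x. (f x)\<^sup>2 \<partial>P)) + ennreal (\<integral>x. (f x)\<^sup>2 \<partial>P)"
    using insert(3) prob_space by (subst nn_integral_add) (auto simp: emeasure_space_1)
  also have "\<dots> = ennreal (real (card (insert j I)) * (\<integral>x. (f x)\<^sup>2 \<partial>P))"
    using insert by (simp add: ennreal_plus[symmetric] algebra_simps del: ennreal_plus)
  finally show ?case .
qed

text \<open>With an infinite variance no block deviates, so that the bad event needs no integrability beyond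
  that of the contrast.\<close>

definition block_deviates :: "'x measure \<Rightarrow> real \<Rightarrow> nat set \<Rightarrow> ('x \<Rightarrow> real) \<Rightarrow> (nat \<Rightarrow> 'x) \<Rightarrow> bool" where
  "block_deviates P c A f y \<longleftrightarrow>
     ennreal c * ext_variance P f < ennreal ((block_mean y A f - (\<integral>x. f x \<partial>P))\<^sup>2)"

text \<open>Chebyshev's inequality: the block mean has variance \<open>v / card A\<close>, and the
  threshold for its squared deviation is \<open>c * v\<close>, so that \<open>v\<close>
  cancels.\<close>

lemma emeasure_block_deviates_le:
  fixes f :: "'x \<Rightarrow> real"
  assumes P: "prob_space P" and f: "integrable P f" and A: "finite A" "A \<noteq> {}" and c: "0 < c"
  shows "emeasure (Pi\<^sub>M A (\<lambda>_. P)) {y \<in> space (Pi\<^sub>M A (\<lambda>_. P)). block_deviates P c A f y}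
    \<le> ennreal (1 / (c * real (card A)))"
proof (cases "ext_variance P f = \<infinity>")
  case True
  then show ?thesis using c by (simp add: block_deviates_def ennreal_mult_top)
next
  case False
  interpret P: prob_space P by fact
  let ?Q = "Pi\<^sub>M A (\<lambda>_. P)"
  define m where "m = (\<integral>x. f x \<partial>P)"
  define g where "g x = f x - m" for x
  define v where "v = (\<integral>x. (g x)\<^sup>2 \<partial>P)"
  have [measurable]: "f \<in> borel_measurable P" using f by auto
  then have gm[measurable]: "g \<in> borel_measurable P" unfolding g_def by measurable
  have g: "integrable P g" "(\<integral>x. g x \<partial>P) = 0" unfolding g_def using f by (auto simp: P.prob_space m_def)
  have ev: "ext_variance P f = (\<integral>\<^sup>+x. ennreal ((g x)\<^sup>2) \<partial>P)" by (simp add: ext_variance_def g_def m_def)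
  have g2: "integrable P (\<lambda>x. (g x)\<^sup>2)"
    using False unfolding ev by (intro integrableI_nonneg) (auto simp: less_top)
  have ev': "ext_variance P f = ennreal v" unfolding ev v_def using g2 by (intro nn_integral_eq_integral) auto
  have v0: "0 \<le> v" unfolding v_def by simp
  have card: "0 < real (card A)" using A by (simp add: card_gt_0_iff)
  have mean: "block_mean y A f - m = (\<Sum>i\<in>A. g (y i)) / real (card A)" for y
    using card by (simp add: block_mean_def g_def sum_subtractf field_simps)
  define Z where "Z y = (block_mean y A f - m)\<^sup>2" for y
  have [measurable]: "Z \<in> borel_measurable ?Q" unfolding Z_def mean by measurable
  have EZ: "(\<integral>\<^sup>+y. ennreal (Z y) \<partial>?Q) = ennreal (v / real (card A))"
  proof -
    have "(\<integral>\<^sup>+y. ennreal (Z y) \<partial>?Q)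
        = (\<integral>\<^sup>+y. ennreal (1 / (real (card A))\<^sup>2) * ennreal ((\<Sum>i\<in>A. g (y i))\<^sup>2) \<partial>?Q)"
      by (intro nn_integral_cong) (simp add: Z_def mean power_divide ennreal_mult[symmetric])
    also have "\<dots> = ennreal (1 / (real (card A))\<^sup>2) * ennreal (real (card A) * v)"
      unfolding v_def using nn_integral_PiM_sum_sqr[OF P g g2 A(1)] by (subst nn_integral_cmult) auto
    also have "\<dots> = ennreal (v / real (card A))"
      using v0 card by (simp add: ennreal_mult[symmetric] power2_eq_square)
    finally show ?thesis .
  qed
  have dev: "block_deviates P c A f y \<longleftrightarrow> c * v < Z y" for y
    using c v0 by (simp add: block_deviates_def ev' Z_def m_def ennreal_mult[symmetric] ennreal_less_iff)
  show ?thesis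
  \<comment> \<open>Markov's inequality would divide by \<open>c * v\<close>. For
    \<open>v = 0\<close> the block mean equals its expectation almost surely, so the strict
    deviation has probability zero.\<close>
  proof (cases "v = 0")
    case True
    then have "AE y in ?Q. ennreal (Z y) = 0" using EZ by (simp add: nn_integral_0_iff_AE)
    then have "AE y in ?Q. \<not> c * v < Z y" by (rule eventually_mono) (simp add: True ennreal_eq_0_iff)
    then have "emeasure ?Q {y \<in> space ?Q. c * v < Z y} = 0" by (subst (asm) AE_iff_measurable[OF _ refl]) auto
    then show ?thesis unfolding dev by simp
  next
    case False
    then have cv: "0 < c * v" using c v0 by simp
    have "emeasure ?Q {y \<in> space ?Q. c * v < Z y}
        \<le> emeasure ?Q {y \<in> space ?Q. 1 \<le> ennreal (1 / (c * v)) * ennreal (Z y)}"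
    proof (intro emeasure_mono subsetI)
      fix y assume "y \<in> {y \<in> space ?Q. c * v < Z y}"
      then show "y \<in> {y \<in> space ?Q. 1 \<le> ennreal (1 / (c * v)) * ennreal (Z y)}"
        using cv by (auto simp: ennreal_mult[symmetric] Z_def field_simps)
    qed measurable
    also have "\<dots> \<le> ennreal (1 / (c * v)) * (\<integral>\<^sup>+y. ennreal (Z y) * indicator (space ?Q) y \<partial>?Q)"
      by (intro nn_integral_Markov_inequality) auto
    also have "(\<integral>\<^sup>+y. ennreal (Z y) * indicator (space ?Q) y \<partial>?Q) = ennreal (v / real (card A))"
      unfolding EZ[symmetric] by (intro nn_integral_cong) auto
    also have "ennreal (1 / (c * v)) * ennreal (v / real (card A)) = ennreal (1 / (c * real (card A)))"
      using c v0 False card by (simp add: ennreal_mult[symmetric])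
    finally show ?thesis unfolding dev .
  qed
qed

section \<open>Conditioning on a pair of blocks\<close>

text \<open>Here \<open>w\<close> stands for the data from which the estimators are computed and
  \<open>y\<close> for an independent block; joint measurability permits integrating over
  \<open>y\<close> first.\<close>

lemma measurable_block_deviates:
  fixes g :: "'w \<Rightarrow> 'x \<Rightarrow> real"
  assumes "prob_space P" and [measurable]: "(\<lambda>(w, x). g w x) \<in> borel_measurable (N \<Otimes>\<^sub>M P)"
  shows "Measurable.pred (N \<Otimes>\<^sub>M Pi\<^sub>M A (\<lambda>_. P)) (\<lambda>(w, y). block_deviates P c A (g w) y)"
proof -
  interpret prob_space P by fact
  have [measurable]: "(\<lambda>w. \<integral>x. g w x \<partial>P) \<in> borel_measurable N"
    using assms(2) by (rule borel_measurable_lebesgue_integral)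
  have [measurable]: "(\<lambda>w. ext_variance P (g w)) \<in> borel_measurable N"
    unfolding ext_variance_def by measurable
  have [measurable]: "(\<lambda>q. block_mean (snd q) A (g (fst q))) \<in> borel_measurable (N \<Otimes>\<^sub>M Pi\<^sub>M A (\<lambda>_. P))"
    unfolding block_mean_def
  proof (intro borel_measurable_divide borel_measurable_sum borel_measurable_const)
    fix i assume "i \<in> A"
    then have "(\<lambda>q. (fst q, snd q i)) \<in> measurable (N \<Otimes>\<^sub>M Pi\<^sub>M A (\<lambda>_. P)) (N \<Otimes>\<^sub>M P)" by measurable
    from measurable_compose[OF this assms(2)]
    show "(\<lambda>q. g (fst q) (snd q i)) \<in> borel_measurable (N \<Otimes>\<^sub>M Pi\<^sub>M A (\<lambda>_. P))" by simp
  qed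
  show ?thesis unfolding block_deviates_def split_beta' by measurable
qed

text \<open>Once the coordinates in \<open>D\<close> are fixed, each factor depends on a single
  coordinate of its own, so the coordinates in \<open>A\<close> can be integrated out one after the
  other. Each integration costs a factor \<open>p j\<close> that is uniform in the fixed
  coordinates.\<close>

lemma (in product_prob_space) nn_integral_prod_conditional_le:
  fixes h :: "'i \<Rightarrow> ('i \<Rightarrow> 'a) \<Rightarrow> 'a \<Rightarrow> ennreal"
  assumes "finite D" and "finite A" and "D \<inter> A = {}"
    and "\<And>j. j \<in> A \<Longrightarrow> (\<lambda>(x, y). h j x y) \<in> borel_measurable (Pi\<^sub>M D M \<Otimes>\<^sub>M M j)"
    and "\<And>j x. j \<in> A \<Longrightarrow> x \<in> space (Pi\<^sub>M D M) \<Longrightarrow> (\<integral>\<^sup>+y. h j x y \<partial>M j) \<le> p j"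
  shows "(\<integral>\<^sup>+x. (\<Prod>j\<in>A. h j (restrict x D) (x j)) \<partial>Pi\<^sub>M (D \<union> A) M) \<le> (\<Prod>j\<in>A. p j)"
  using assms(2-)
proof (induction A rule: finite_induct)
  case empty
  interpret D: prob_space "Pi\<^sub>M D M" by (intro prob_space_PiM) (rule M.prob_space_axioms)
  show ?case by (simp add: D.emeasure_space_1)
next
  case (insert a A)
  have meas: "(\<lambda>x. h j (restrict x D) (x j)) \<in> borel_measurable (Pi\<^sub>M (D \<union> B) M)"
    if "j \<in> insert a A" "j \<in> B" for j B
  proof -
    have "(\<lambda>x. (restrict x D, x j)) \<in> measurable (Pi\<^sub>M (D \<union> B) M) (Pi\<^sub>M D M \<Otimes>\<^sub>M M j)"
      using that by (intro measurable_Pair measurable_restrict_subset measurable_component_singleton) auto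
    from measurable_compose[OF this insert.prems(2)[OF that(1)]] show ?thesis by simp
  qed
  have aD: "a \<notin> D \<union> A" using insert by auto
  have upd: "(\<Prod>j\<in>insert a A. h j (restrict (x(a := y)) D) ((x(a := y)) j))
      = (\<Prod>j\<in>A. h j (restrict x D) (x j)) * h a (restrict x D) y" for x y
  proof -
    have "restrict (x(a := y)) D = restrict x D" using aD by auto
    moreover have "(\<Prod>j\<in>A. h j (restrict x D) ((x(a := y)) j)) = (\<Prod>j\<in>A. h j (restrict x D) (x j))"
      using aD by (intro prod.cong) auto
    ultimately show ?thesis using insert by (simp add: mult.commute)
  qed
  have "(\<integral>\<^sup>+x. (\<Prod>j\<in>insert a A. h j (restrict x D) (x j)) \<partial>Pi\<^sub>M (D \<union> insert a A) M)
    = (\<integral>\<^sup>+x. (\<integral>\<^sup>+y. (\<Prod>j\<in>insert a A. h j (restrict (x(a := y)) D) ((x(a := y)) j)) \<partial>M a) \<partial>Pi\<^sub>M (D \<union> A) M)"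
  proof -
    have "(\<lambda>x. \<Prod>j\<in>insert a A. h j (restrict x D) (x j)) \<in> borel_measurable (Pi\<^sub>M (insert a (D \<union> A)) M)"
      using meas[of _ "insert a A"] by (intro borel_measurable_prod_ennreal) simp
    from product_nn_integral_insert[OF _ aD this] assms(1) insert(1) show ?thesis by simp
  qed
  also have "\<dots> \<le> (\<integral>\<^sup>+x. (\<Prod>j\<in>A. h j (restrict x D) (x j)) * p a \<partial>Pi\<^sub>M (D \<union> A) M)"
  proof (rule nn_integral_mono)
    fix x assume "x \<in> space (Pi\<^sub>M (D \<union> A) M)"
    then have x: "restrict x D \<in> space (Pi\<^sub>M D M)" by (auto simp: space_PiM)
    have "h a (restrict x D) \<in> borel_measurable (M a)"
      using measurable_compose[OF measurable_Pair1'[OF x] insert.prems(2)[of a]] by simp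
    then have "(\<integral>\<^sup>+y. (\<Prod>j\<in>A. h j (restrict x D) (x j)) * h a (restrict x D) y \<partial>M a)
        = (\<Prod>j\<in>A. h j (restrict x D) (x j)) * (\<integral>\<^sup>+y. h a (restrict x D) y \<partial>M a)"
      by (rule nn_integral_cmult)
    also have "\<dots> \<le> (\<Prod>j\<in>A. h j (restrict x D) (x j)) * p a"
      by (intro mult_left_mono insert.prems(3)[OF insertI1 x]) simp
    finally show "(\<integral>\<^sup>+y. (\<Prod>j\<in>insert a A. h j (restrict (x(a := y)) D) ((x(a := y)) j)) \<partial>M a)
        \<le> (\<Prod>j\<in>A. h j (restrict x D) (x j)) * p a"
      unfolding upd .
  qed
  also have "\<dots> = (\<integral>\<^sup>+x. (\<Prod>j\<in>A. h j (restrict x D) (x j)) \<partial>Pi\<^sub>M (D \<union> A) M) * p a"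
    using meas[of _ A] by (intro nn_integral_multc borel_measurable_prod_ennreal) auto
  also have "\<dots> \<le> (\<Prod>j\<in>A. p j) * p a"
    using insert by (intro mult_right_mono insert.IH) auto
  also have "\<dots> = (\<Prod>j\<in>insert a A. p j)"
    using insert(1,2) by (simp add: mult.commute)
  finally show ?case .
qed

text \<open>By independence the joint law of the \<open>Y j\<close> is the product of the
  \<open>N j\<close>, and the indicator of the event is a product of indicators, to which the
  preceding integral bound applies.\<close>

lemma (in prob_space) indep_vars_conditional_prob_le:
  assumes indep: "indep_vars N Y I" and law: "\<And>j. j \<in> I \<Longrightarrow> distr M (N j) (Y j) = N j"
    and N: "\<And>j. prob_space (N j)"
    and fin: "finite D" "finite A" and "D \<noteq> {}" and disj: "D \<inter> A = {}" and sub: "D \<union> A \<subseteq> I"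
    and meas: "\<And>j. j \<in> A \<Longrightarrow> Measurable.pred (Pi\<^sub>M D N \<Otimes>\<^sub>M N j) (\<lambda>(x, y). Q j x y)"
    and le: "\<And>j x. j \<in> A \<Longrightarrow> x \<in> space (Pi\<^sub>M D N) \<Longrightarrow> emeasure (N j) {y \<in> space (N j). Q j x y} \<le> p j"
  shows "{\<omega> \<in> space M. \<forall>j\<in>A. Q j (\<lambda>i\<in>D. Y i \<omega>) (Y j \<omega>)} \<in> events"
    and "emeasure M {\<omega> \<in> space M. \<forall>j\<in>A. Q j (\<lambda>i\<in>D. Y i \<omega>) (Y j \<omega>)} \<le> (\<Prod>j\<in>A. p j)"
proof -
  interpret N: product_prob_space N D
    using N by (rule product_prob_spaceI)
  have rv: "random_variable (N j) (Y j)" if "j \<in> I" for j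
    using indep that by (auto simp: indep_vars_def)
  have pair: "(\<lambda>\<omega>. (\<lambda>i\<in>D. Y i \<omega>, Y j \<omega>)) \<in> measurable M (Pi\<^sub>M D N \<Otimes>\<^sub>M N j)" if "j \<in> A" for j
    using that sub rv by (intro measurable_Pair measurable_restrict) auto
  have pred: "Measurable.pred M (\<lambda>\<omega>. Q j (\<lambda>i\<in>D. Y i \<omega>) (Y j \<omega>))" if "j \<in> A" for j
    using measurable_compose[OF pair[OF that] meas[OF that]] by simp
  show ev: "{\<omega> \<in> space M. \<forall>j\<in>A. Q j (\<lambda>i\<in>D. Y i \<omega>) (Y j \<omega>)} \<in> events"
    using pred fin by (intro predE pred_intros_finite) auto
  define h :: "_ \<Rightarrow> _ \<Rightarrow> _ \<Rightarrow> ennreal" where "h j x y = (if Q j x y then 1 else 0)" for j x y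
  have hm: "(\<lambda>(x, y). h j x y) \<in> borel_measurable (Pi\<^sub>M D N \<Otimes>\<^sub>M N j)" if "j \<in> A" for j
    unfolding h_def split_beta' using meas[OF that, unfolded split_beta'] by measurable
  have joint: "distr M (Pi\<^sub>M (D \<union> A) N) (\<lambda>\<omega>. \<lambda>i\<in>D \<union> A. Y i \<omega>) = Pi\<^sub>M (D \<union> A) N"
  proof -
    have "distr M (Pi\<^sub>M (D \<union> A) N) (\<lambda>\<omega>. \<lambda>i\<in>D \<union> A. Y i \<omega>) = (\<Pi>\<^sub>M i\<in>D \<union> A. distr M (N i) (Y i))"
      using indep_vars_subset[OF indep sub] \<open>D \<noteq> {}\<close> sub rv
      by (subst (asm) indep_vars_iff_distr_eq_PiM') auto
    also have "\<dots> = Pi\<^sub>M (D \<union> A) N" using sub law by (intro PiM_cong) auto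
    finally show ?thesis .
  qed
  have rvD: "(\<lambda>\<omega>. \<lambda>i\<in>D \<union> A. Y i \<omega>) \<in> measurable M (Pi\<^sub>M (D \<union> A) N)"
    using sub rv by (intro measurable_restrict) auto
  have hmD: "(\<lambda>x. \<Prod>j\<in>A. h j (restrict x D) (x j)) \<in> borel_measurable (Pi\<^sub>M (D \<union> A) N)"
  proof (rule borel_measurable_prod_ennreal)
    fix j assume j: "j \<in> A"
    have "(\<lambda>x. (restrict x D, x j)) \<in> measurable (Pi\<^sub>M (D \<union> A) N) (Pi\<^sub>M D N \<Otimes>\<^sub>M N j)"
      using j by (intro measurable_Pair measurable_restrict_subset measurable_component_singleton) auto
    from measurable_compose[OF this hm[OF j]]
    show "(\<lambda>x. h j (restrict x D) (x j)) \<in> borel_measurable (Pi\<^sub>M (D \<union> A) N)" by simp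
  qed
  have "emeasure M {\<omega> \<in> space M. \<forall>j\<in>A. Q j (\<lambda>i\<in>D. Y i \<omega>) (Y j \<omega>)}
      = (\<integral>\<^sup>+\<omega>. indicator {\<omega> \<in> space M. \<forall>j\<in>A. Q j (\<lambda>i\<in>D. Y i \<omega>) (Y j \<omega>)} \<omega> \<partial>M)"
    using ev by simp
  also have "\<dots> = (\<integral>\<^sup>+\<omega>. (\<Prod>j\<in>A. h j (restrict (\<lambda>i\<in>D \<union> A. Y i \<omega>) D) ((\<lambda>i\<in>D \<union> A. Y i \<omega>) j)) \<partial>M)"
  proof (rule nn_integral_cong)
    fix \<omega> assume "\<omega> \<in> space M"
    have "restrict (\<lambda>i\<in>D \<union> A. Y i \<omega>) D = (\<lambda>i\<in>D. Y i \<omega>)" by (auto simp: restrict_def)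
    then show "indicator {\<omega> \<in> space M. \<forall>j\<in>A. Q j (\<lambda>i\<in>D. Y i \<omega>) (Y j \<omega>)} \<omega>
        = (\<Prod>j\<in>A. h j (restrict (\<lambda>i\<in>D \<union> A. Y i \<omega>) D) ((\<lambda>i\<in>D \<union> A. Y i \<omega>) j))"
      using \<open>\<omega> \<in> space M\<close> fin(2) by (auto simp: h_def indicator_def intro!: prod.neutral[symmetric])
  qed
  also have "\<dots> = (\<integral>\<^sup>+x. (\<Prod>j\<in>A. h j (restrict x D) (x j)) \<partial>Pi\<^sub>M (D \<union> A) N)"
    using nn_integral_distr[OF rvD, of "\<lambda>x. \<Prod>j\<in>A. h j (restrict x D) (x j)"] hmD unfolding joint by simp
  also have "\<dots> \<le> (\<Prod>j\<in>A. p j)"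
  proof (rule N.nn_integral_prod_conditional_le[OF fin disj hm])
    fix j x assume j: "j \<in> A" and x: "x \<in> space (Pi\<^sub>M D N)"
    have "h j x \<in> borel_measurable (N j)"
      using measurable_compose[OF measurable_Pair1'[OF x] hm[OF j]] by simp
    then have "{y \<in> space (N j). h j x y = 1} \<in> sets (N j)" by measurable
    moreover have "{y \<in> space (N j). h j x y = 1} = {y \<in> space (N j). Q j x y}" by (auto simp: h_def)
    ultimately have "emeasure (N j) {y \<in> space (N j). Q j x y}
        = (\<integral>\<^sup>+y. indicator {y \<in> space (N j). Q j x y} y \<partial>N j)" by (simp only: nn_integral_indicator)
    also have "\<dots> = (\<integral>\<^sup>+y. h j x y \<partial>N j)"
      by (intro nn_integral_cong) (auto simp: h_def indicator_def)
    finally have "(\<integral>\<^sup>+y. h j x y \<partial>N j) = emeasure (N j) {y \<in> space (N j). Q j x y}" by (rule sym)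
    then show "(\<integral>\<^sup>+y. h j x y \<partial>N j) \<le> p j" using le[OF j x] by simp
  qed
  finally show "emeasure M {\<omega> \<in> space M. \<forall>j\<in>A. Q j (\<lambda>i\<in>D. Y i \<omega>) (Y j \<omega>)} \<le> (\<Prod>j\<in>A. p j)" .
qed

section \<open>Unordered pairs, the union bound and medians\<close>

text \<open>The deviation is squared, so the sign of the contrast difference is immaterial. This
  allows the bad event to be indexed by unordered pairs, although the medians belong to ordered
  ones.\<close>

lemma block_deviates_minus_commute:
  "block_deviates P c A (\<lambda>x. f x - g x) = block_deviates P c A (\<lambda>x. g x - f x)"
proof -
  have neg: "(\<lambda>x. f x - g x) = (\<lambda>x. - (g x - f x))" by auto
  have sq: "(- a - - b)\<^sup>2 = (a - b)\<^sup>2" for a b :: real by (simp add: power2_eq_square algebra_simps)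
  have "block_mean y A (\<lambda>x. - (g x - f x)) = - block_mean y A (\<lambda>x. g x - f x)" for y
    unfolding block_mean_def sum_negf by simp
  then show ?thesis
    unfolding neg block_deviates_def ext_variance_def integral_minus by (simp only: sq)
qed

text \<open>\<open>V\<close> is \<open>2 * k + 1\<close> or \<open>2 * k + 2\<close>. Every factor
  is monotone in \<open>V\<close>, so both parities reduce to the larger value, where
  \<open>V / 2\<close> is \<open>k + 1\<close>.\<close>

lemma union_bound_le:
  assumes "8 \<le> V" and k: "k = (V - 1) div 2"
  shows "real ((V - k) choose 2) * ((2 / 3 * r_const * real V) ^ k / fact k) \<le> exp (- real V / 2)"
proof -
  have k3: "3 \<le> k" and V: "V \<le> 2 * k + 2" using assms by auto
  have r: "2 / 3 * r_const * real V \<le> 2 * (real k + 1) * (2 / 75)"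
  proof -
    have "r_const * real V \<le> (1 / 25) * (2 * real k + 2)"
      using r_const_le r_const_pos V by (intro mult_mono) auto
    then show ?thesis by (simp add: algebra_simps)
  qed
  have "real ((V - k) choose 2) * ((2 / 3 * r_const * real V) ^ k / fact k)
      \<le> real ((k + 2) choose 2) * ((2 * (real k + 1) * (2 / 75)) ^ k / fact k)"
    using r r_const_pos V
    by (intro mult_mono divide_right_mono power_mono[OF r] of_nat_mono binomial_right_mono) auto
  also have "\<dots> \<le> exp (- (real k + 1))" using k3 by (rule union_bound_numeric)
  also have "\<dots> \<le> exp (- real V / 2)" using V by simp
  finally show ?thesis .
qed

text \<open>If \<open>b\<close> missed \<open>l\<close> by more than \<open>t\<close>, then so would
  all values on the far side of \<open>b\<close>, and these are at least half of them.\<close>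

lemma median_close:
  assumes "finite I" and med: "is_median I a b"
    and few: "real (card {i \<in> I. t < \<bar>a i - l\<bar>}) < real (card I) / 2"
  shows "\<bar>b - l\<bar> \<le> t"
proof (rule ccontr)
  assume "\<not> ?thesis"
  then consider "t < l - b" | "t < b - l" by linarith
  then have "real (card I) / 2 \<le> real (card {i \<in> I. t < \<bar>a i - l\<bar>})"
  proof cases
    case 1
    have "card {i \<in> I. a i \<le> b} \<le> card {i \<in> I. t < \<bar>a i - l\<bar>}"
      using assms(1) 1 by (intro card_mono) auto
    then show ?thesis using med unfolding is_median_def by linarith
  next
    case 2
    have "card {i \<in> I. a i \<ge> b} \<le> card {i \<in> I. t < \<bar>a i - l\<bar>}"
      using assms(1) 2 by (intro card_mono) auto
    then show ?thesis using med unfolding is_median_def by linarith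
  qed
  with few show False by simp
qed

section \<open>From the margin condition to the oracle inequality\<close>

text \<open>The triangle inequality for standard deviations, by Cauchy-Schwarz for nonnegative
  integrals. Absolute deviations are used because \<open>ennreal\<close> sends negative numbers to
  zero.\<close>

lemma ext_variance_minus_le:
  fixes f g :: "'x \<Rightarrow> real"
  assumes f: "integrable P f" and g: "integrable P g" and "0 \<le> a" "0 \<le> b"
    and vf: "ext_variance P f \<le> ennreal (a\<^sup>2)" and vg: "ext_variance P g \<le> ennreal (b\<^sup>2)"
  shows "ext_variance P (\<lambda>x. f x - g x) \<le> ennreal ((a + b)\<^sup>2)"
proof -
  define u where "u x = ennreal \<bar>f x - (\<integral>y. f y \<partial>P)\<bar>" for x
  define v where "v x = ennreal \<bar>g x - (\<integral>y. g y \<partial>P)\<bar>" for x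
  have [measurable]: "u \<in> borel_measurable P" "v \<in> borel_measurable P"
    using f g unfolding u_def v_def by measurable
  have u2: "(\<integral>\<^sup>+x. (u x)\<^sup>2 \<partial>P) \<le> ennreal (a\<^sup>2)" and v2: "(\<integral>\<^sup>+x. (v x)\<^sup>2 \<partial>P) \<le> ennreal (b\<^sup>2)"
    using vf vg by (auto simp: ext_variance_def u_def v_def ennreal_power)
  have "(\<integral>\<^sup>+x. u x * v x \<partial>P)\<^sup>2 \<le> (\<integral>\<^sup>+x. (u x)\<^sup>2 \<partial>P) * (\<integral>\<^sup>+x. (v x)\<^sup>2 \<partial>P)"
    by (rule Cauchy_Schwarz_nn_integral) auto
  also have "\<dots> \<le> ennreal (a\<^sup>2) * ennreal (b\<^sup>2)" using u2 v2 by (intro mult_mono) auto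
  also have "\<dots> = (ennreal (a * b))\<^sup>2"
    using assms by (simp add: ennreal_mult[symmetric] ennreal_power power_mult_distrib)
  finally have "(\<integral>\<^sup>+x. u x * v x \<partial>P)\<^sup>2 \<le> (ennreal (a * b))\<^sup>2" .
  then have uv: "(\<integral>\<^sup>+x. u x * v x \<partial>P) \<le> ennreal (a * b)"
  proof (cases "\<integral>\<^sup>+x. u x * v x \<partial>P" rule: ennreal_cases)
    case (real w)
    then show ?thesis
      using \<open>(\<integral>\<^sup>+x. u x * v x \<partial>P)\<^sup>2 \<le> (ennreal (a * b))\<^sup>2\<close> assms(3,4)
      by (auto simp: ennreal_power intro!: ennreal_leI power2_le_imp_le[of w "a * b"])
  next
    case top
    then show ?thesis
      using \<open>(\<integral>\<^sup>+x. u x * v x \<partial>P)\<^sup>2 \<le> (ennreal (a * b))\<^sup>2\<close> assms(3,4) by (simp add: power2_eq_square ennreal_mult[symmetric] top_unique)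
  qed
  have "ext_variance P (\<lambda>x. f x - g x) \<le> (\<integral>\<^sup>+x. (u x)\<^sup>2 + (2 * (u x * v x) + (v x)\<^sup>2) \<partial>P)"
    unfolding ext_variance_def
  proof (rule nn_integral_mono)
    fix x
    define p where "p = f x - (\<integral>y. f y \<partial>P)"
    define q where "q = g x - (\<integral>y. g y \<partial>P)"
    have "(f x - g x - (\<integral>y. f y - g y \<partial>P))\<^sup>2 = (p - q)\<^sup>2"
      using f g by (simp add: p_def q_def algebra_simps)
    also have "\<dots> \<le> (\<bar>p\<bar> + \<bar>q\<bar>)\<^sup>2" by (intro abs_le_square_iff[THEN iffD1]) auto
    also have "\<dots> = \<bar>p\<bar>\<^sup>2 + (2 * (\<bar>p\<bar> * \<bar>q\<bar>) + \<bar>q\<bar>\<^sup>2)" by (simp add: power2_sum)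
    finally have "ennreal ((f x - g x - (\<integral>y. f y - g y \<partial>P))\<^sup>2) \<le> ennreal (\<bar>p\<bar>\<^sup>2 + (2 * (\<bar>p\<bar> * \<bar>q\<bar>) + \<bar>q\<bar>\<^sup>2))"
      by (rule ennreal_leI)
    also have "\<dots> = (u x)\<^sup>2 + (2 * (u x * v x) + (v x)\<^sup>2)"
      by (simp add: u_def v_def p_def[symmetric] q_def[symmetric] ennreal_mult ennreal_power)
    finally show "ennreal ((f x - g x - (\<integral>y. f y - g y \<partial>P))\<^sup>2) \<le> (u x)\<^sup>2 + (2 * (u x * v x) + (v x)\<^sup>2)" .
  qed
  also have "\<dots> = (\<integral>\<^sup>+x. (u x)\<^sup>2 \<partial>P) + (2 * (\<integral>\<^sup>+x. u x * v x \<partial>P) + (\<integral>\<^sup>+x. (v x)\<^sup>2 \<partial>P))"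
    by (simp add: nn_integral_add nn_integral_cmult)
  also have "\<dots> \<le> ennreal (a\<^sup>2) + (2 * ennreal (a * b) + ennreal (b\<^sup>2))"
    using u2 v2 uv by (intro add_mono mult_left_mono) auto
  also have "\<dots> = ennreal ((a + b)\<^sup>2)"
    using assms by (simp add: power2_sum ennreal_mult[symmetric] flip: ennreal_plus ennreal_numeral)
  finally show ?thesis .
qed

lemma rpow_double: "0 \<le> x \<Longrightarrow> rpow x (2 * a) = (rpow x a)\<^sup>2"
  by (simp add: rpow_def powr_add[symmetric] power2_eq_square)

lemma rpow_nonneg: "0 \<le> rpow x a"
  by (simp add: rpow_def)

text \<open>The cross products are nonnegative. Thus a sum of variance terms is bounded by the
  square of the sum of the corresponding standard deviations.\<close>

lemma sum_sqr_le_sqr_sum: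
  fixes f :: "'a \<Rightarrow> real"
  assumes "\<And>i. i \<in> I \<Longrightarrow> 0 \<le> f i"
  shows "(\<Sum>i\<in>I. (f i)\<^sup>2) \<le> (\<Sum>i\<in>I. f i)\<^sup>2"
proof (cases "finite I")
  case True
  then show ?thesis using assms
  proof (induction I)
    case (insert j I)
    then have "0 \<le> f j * (\<Sum>i\<in>I. f i)" by (intro mult_nonneg_nonneg sum_nonneg) auto
    with insert show ?case by (simp add: power2_sum)
  qed simp
qed simp

text \<open>Young's inequality with exponents \<open>1 / \<alpha>\<close> and
  \<open>1 / (1 - \<alpha>)\<close>, for positive \<alpha>. The first factor is scaled so that its
  term is exactly \<open>l / \<Delta>\<close>; this scaling produces the factor
  \<open>rpow \<alpha> \<alpha>\<close> of \<open>C_const\<close>.\<close>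

lemma power_term_le:
  assumes \<alpha>: "0 \<le> \<alpha>" "\<alpha> < 1" and "0 < \<Delta>" "0 \<le> l" "0 \<le> s" "0 < c"
  shows "c * (s * rpow l \<alpha>)
    \<le> l / \<Delta> + (1 - \<alpha>) * (c * rpow \<alpha> \<alpha>) powr (1 / (1 - \<alpha>)) * (\<Delta> powr \<alpha> * s) powr (1 / (1 - \<alpha>))"
proof (cases "\<alpha> = 0")
  case True
  then show ?thesis using assms by (simp add: rpow_def powr_mult)
next
  case False
  then have a: "0 < \<alpha>" using \<alpha> by simp
  show ?thesis
  proof (cases "l = 0 \<or> s = 0")
    case True
    then show ?thesis using assms a by (auto simp: rpow_def)
  next
    case F: False
    then have l: "0 < l" and s: "0 < s" using assms by auto
    define y where "y = c * \<alpha> powr \<alpha> * (\<Delta> powr \<alpha> * s)"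
    have y: "0 < y" using assms a s by (simp add: y_def)
    have "(l / (\<Delta> * \<alpha>)) powr \<alpha> * (y powr (1 / (1 - \<alpha>))) powr (1 - \<alpha>)
        \<le> \<alpha> * (l / (\<Delta> * \<alpha>)) + (1 - \<alpha>) * y powr (1 / (1 - \<alpha>))"
      using assms a l y by (intro Youngs_inequality_0) auto
    also have "(y powr (1 / (1 - \<alpha>))) powr (1 - \<alpha>) = y" using y \<alpha> by (simp add: powr_powr)
    also have "(l / (\<Delta> * \<alpha>)) powr \<alpha> * y = c * (s * l powr \<alpha>)"
      using assms a l by (simp add: y_def powr_divide powr_mult)
    also have "\<alpha> * (l / (\<Delta> * \<alpha>)) = l / \<Delta>" using a by simp
    also have "y powr (1 / (1 - \<alpha>)) = (c * \<alpha> powr \<alpha>) powr (1 / (1 - \<alpha>)) * (\<Delta> powr \<alpha> * s) powr (1 / (1 - \<alpha>))"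
      unfolding y_def by (rule powr_mult)
    finally show ?thesis using a by (simp add: rpow_def mult.assoc)
  qed
qed

text \<open>The factor \<open>4\<close> in \<open>C_const\<close> is one for each standard deviation in the two comparisons made by the
  selection rule.\<close>

lemma std_dev_bound_le:
  assumes \<alpha>: "\<And>i. i \<in> {1..N} \<Longrightarrow> 0 \<le> \<alpha> i \<and> \<alpha> i < 1" and \<sigma>: "\<And>i. i \<in> {0..N} \<Longrightarrow> 0 \<le> \<sigma> i"
    and "1 < \<Delta>" "0 \<le> l"
  shows "L1 * sqrt (real V / real n) * (\<sigma> 0 * l + (\<Sum>i=1..N. \<sigma> i * rpow l (\<alpha> i)))
    \<le> nu N \<sigma> V n \<Delta> * l + remainder N \<alpha> \<sigma> V n \<Delta> / 4"
proof -
  define q where "q = sqrt (real V / real n)"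
  have q: "0 \<le> q" by (simp add: q_def)
  have "L1 * q * (\<Sum>i=1..N. \<sigma> i * rpow l (\<alpha> i)) = (\<Sum>i=1..N. L1 * ((\<sigma> i * q) * rpow l (\<alpha> i)))"
    by (simp add: sum_distrib_left mult_ac)
  also have "\<dots> \<le> (\<Sum>i=1..N. l / \<Delta> + C_const (\<alpha> i) * (\<Delta> powr \<alpha> i * \<sigma> i * q) powr (1 / (1 - \<alpha> i)) / 4)"
  proof (rule sum_mono)
    fix i assume i: "i \<in> {1..N}"
    have "L1 * ((\<sigma> i * q) * rpow l (\<alpha> i)) \<le> l / \<Delta> + (1 - \<alpha> i) * (L1 * rpow (\<alpha> i) (\<alpha> i)) powr (1 / (1 - \<alpha> i))
        * (\<Delta> powr \<alpha> i * (\<sigma> i * q)) powr (1 / (1 - \<alpha> i))"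
      using \<alpha>[OF i] \<sigma>[of i] i assms(3,4) L1_pos q by (intro power_term_le) auto
    moreover have "4 * x * y * z / 4 = x * y * z" for x y z :: real by simp
    ultimately show "L1 * ((\<sigma> i * q) * rpow l (\<alpha> i))
        \<le> l / \<Delta> + C_const (\<alpha> i) * (\<Delta> powr \<alpha> i * \<sigma> i * q) powr (1 / (1 - \<alpha> i)) / 4"
      by (simp only: C_const_def mult.assoc)
  qed
  also have "\<dots> = real N / \<Delta> * l + remainder N \<alpha> \<sigma> V n \<Delta> / 4"
    by (simp add: sum.distrib remainder_def q_def sum_divide_distrib)
  finally show ?thesis
    by (simp add: nu_def q_def algebra_simps)
qed

text \<open>For \<open>\<nu> > 1\<close> the claim holds because its left-hand side is nonpositive.\<close>

lemma selection_excess_le: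
  fixes l :: "'k \<Rightarrow> real" and p :: "'k \<Rightarrow> 'k \<Rightarrow> real"
  assumes "finite I" and l: "\<And>K. K \<in> I \<Longrightarrow> 0 \<le> l K" and "0 \<le> \<nu>" "0 \<le> R"
    and dev: "\<And>K K'. K \<in> I \<Longrightarrow> K' \<in> I \<Longrightarrow> \<bar>p K K' - (l K - l K')\<bar> \<le> \<nu> * (l K + l K') + R / 2"
    and sel: "is_arg_min (\<lambda>K. Max (p K ` I)) (\<lambda>K. K \<in> I) Ks"
  shows "(1 - \<nu>) * l Ks \<le> (1 + 3 * \<nu>) * (INF K\<in>I. l K) + R"
proof -
  have Ks: "Ks \<in> I" and min: "\<And>K. K \<in> I \<Longrightarrow> Max (p Ks ` I) \<le> Max (p K ` I)"
    using sel by (auto simp: is_arg_min_linorder)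
  have "Min (l ` I) \<in> l ` I" using Ks assms(1) by (intro Min_in) auto
  then obtain Ko where Ko: "Ko \<in> I" "l Ko = Min (l ` I)" by auto
  have le: "l Ko \<le> l K" if "K \<in> I" for K using that assms(1) Ko by auto
  have inf: "(INF K\<in>I. l K) = l Ko" using Ks assms(1) Ko by (subst cInf_eq_Min) auto
  show ?thesis
  proof (cases "\<nu> \<le> 1")
    case True
    \<comment> \<open>The deviation bound gives
      \<open>(1 + \<nu>) * l Ko - (1 - \<nu>) * l K + R / 2\<close>. As \<nu> is at most 1,
      replacing \<open>l K\<close> by the smaller \<open>l Ko\<close> can only increase
      this.\<close>
    have "p Ko K \<le> 2 * \<nu> * l Ko + R / 2" if K: "K \<in> I" for K
    proof -
      have "(1 - \<nu>) * l Ko \<le> (1 - \<nu>) * l K" using True le[OF K] by (intro mult_left_mono) auto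
      then show ?thesis using dev[OF Ko(1) K] by (simp add: algebra_simps abs_le_iff)
    qed
    then have "Max (p Ko ` I) \<le> 2 * \<nu> * l Ko + R / 2" using Ks assms(1) by (subst Max_le_iff) auto
    moreover have "p Ks Ko \<le> Max (p Ks ` I)" using assms(1) Ko by auto
    ultimately have "p Ks Ko \<le> 2 * \<nu> * l Ko + R / 2" using min[OF Ko(1)] by linarith
    \<comment> \<open>From below, \<open>p Ks Ko\<close> is at least
      \<open>(1 - \<nu>) * l Ks - (1 + \<nu>) * l Ko - R / 2\<close>; adding
      \<open>2 * \<nu>\<close> to \<open>1 + \<nu>\<close> explains the factor
      \<open>1 + 3 * \<nu>\<close>.\<close>
    then show ?thesis using dev[OF Ks Ko(1)] unfolding inf by (simp add: algebra_simps abs_le_iff)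
  next
    case False
    then have "(1 - \<nu>) * l Ks \<le> 0" using l[OF Ks] by (intro mult_nonpos_nonneg) auto
    moreover have "0 \<le> (1 + 3 * \<nu>) * l Ko" using l[OF Ko(1)] assms(3) by (intro mult_nonneg_nonneg) auto
    ultimately show ?thesis unfolding inf using assms(4) by linarith
  qed
qed

text \<open>\<open>(1 - \<nu>) * (1 + 8 * \<nu>)\<close> exceeds \<open>1 + 3 * \<nu>\<close> by
  \<open>4 * \<nu> * (1 - 2 * \<nu>)\<close>, and \<open>2 * (1 - \<nu>)\<close> exceeds 1 by
  \<open>1 - 2 * \<nu>\<close>; then \<open>1 - \<nu>\<close> is cancelled.\<close>

lemma excess_le_of_half:
  fixes \<nu> a m R :: real
  assumes "(1 - \<nu>) * a \<le> (1 + 3 * \<nu>) * m + R" and "0 \<le> \<nu>" "\<nu> \<le> 1 / 2" "0 \<le> m" "0 \<le> R"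
  shows "a \<le> (1 + 8 * \<nu>) * m + 2 * R"
proof -
  have "0 \<le> \<nu> * (1 - 2 * \<nu>) * m" using assms by (intro mult_nonneg_nonneg) auto
  moreover have "0 \<le> (1 - 2 * \<nu>) * R" using assms by (intro mult_nonneg_nonneg) auto
  ultimately have "(1 + 3 * \<nu>) * m + R \<le> (1 - \<nu>) * ((1 + 8 * \<nu>) * m + 2 * R)"
    by (simp add: algebra_simps)
  with assms(1) have "(1 - \<nu>) * a \<le> (1 - \<nu>) * ((1 + 8 * \<nu>) * m + 2 * R)" by simp
  then show ?thesis using assms(3) by simp
qed

theorem theorem9:
  fixes M :: "'w measure" and P :: "'x measure" and X :: "nat \<Rightarrow> 'w \<Rightarrow> 'x"
    and T S :: "'t set" and \<gamma> :: "'t \<Rightarrow> 'x \<Rightarrow> real" and s_star s_o :: 't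
    and n V N :: nat and \<delta> \<epsilon> :: real and B :: "nat \<Rightarrow> nat set"
    and F :: "(nat \<Rightarrow> 'x) \<Rightarrow> 't" and s_hat :: "nat \<Rightarrow> 'w \<Rightarrow> 't"
    and \<alpha> \<sigma> :: "nat \<Rightarrow> real" and \<Omega>\<^sub>\<epsilon> :: "'w set"
    and P_bar :: "nat \<Rightarrow> nat \<Rightarrow> 'w \<Rightarrow> real" and K_star :: "'w \<Rightarrow> nat"
  assumes "prob_space M"
    and indep: "prob_space.indep_vars M (\<lambda>_. P) X {1..n}"
    and ident: "\<And>i. i \<in> {1..n} \<Longrightarrow> distr M P (X i) = P"
    and contrast: "\<And>t. t \<in> T \<Longrightarrow> integrable P (\<gamma> t)"
    and target: "is_arg_min (\<lambda>t. \<integral>x. \<gamma> t x \<partial>P) (\<lambda>t. t \<in> T) s_star"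
    and "S \<subseteq> T"
    and best_in_S: "is_arg_min (\<lambda>t. \<integral>x. \<gamma> t x \<partial>P) (\<lambda>t. t \<in> S) s_o"
    and "\<delta> > 0"
    and "real_of_int \<lceil>ln (\<delta> powi (-2))\<rceil> \<le> real n / 2"
    and V: "int V = max \<lceil>ln (\<delta> powi (-2))\<rceil> 8"
    and "real V \<le> real n / 2"
    and "regular_partition n V B"
    and F_range: "\<And>K y. K \<in> {1..V} \<Longrightarrow> y \<in> space (Pi\<^sub>M (B K) (\<lambda>_. P)) \<Longrightarrow> F y \<in> S"
    and F_meas: "\<And>K. K \<in> {1..V} \<Longrightarrow>
      (\<lambda>(y, x). \<gamma> (F y) x) \<in> borel_measurable (Pi\<^sub>M (B K) (\<lambda>_. P) \<Otimes>\<^sub>M P)"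
    and s_hat: "\<And>K \<omega>. K \<in> {1..V} \<Longrightarrow> \<omega> \<in> space M \<Longrightarrow>
      s_hat K \<omega> = F (\<lambda>i\<in>B K. X i \<omega>)"
    and \<alpha>: "\<And>i. i \<in> {1..N} \<Longrightarrow> 0 \<le> \<alpha> i \<and> \<alpha> i < 1"
    and \<sigma>: "\<And>i. i \<in> {0..N} \<Longrightarrow> 0 \<le> \<sigma> i"
    and "\<epsilon> \<le> 1"
    and "\<Omega>\<^sub>\<epsilon> \<in> sets M" and "measure M \<Omega>\<^sub>\<epsilon> \<ge> 1 - \<epsilon>"
    and margin: "\<And>\<omega> K. \<omega> \<in> \<Omega>\<^sub>\<epsilon> \<Longrightarrow> K \<in> {1..V} \<Longrightarrow>
      ext_variance P (\<lambda>x. \<gamma> (s_hat K \<omega>) x - \<gamma> s_o x)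
        \<le> ennreal ((\<sigma> 0)\<^sup>2 * (excess_loss P \<gamma> (s_hat K \<omega>) s_o)\<^sup>2
            + (\<Sum>i=1..N. (\<sigma> i)\<^sup>2 * rpow (excess_loss P \<gamma> (s_hat K \<omega>) s_o) (2 * \<alpha> i)))"
    and P_bar: "\<And>\<omega> K K'. \<omega> \<in> space M \<Longrightarrow> K \<in> {1..V} \<Longrightarrow> K' \<in> {1..V} \<Longrightarrow>
      is_median ({1..V} - {K, K'})
        (\<lambda>J. block_mean (\<lambda>i. X i \<omega>) (B J) (\<lambda>x. \<gamma> (s_hat K \<omega>) x - \<gamma> (s_hat K' \<omega>) x))
        (P_bar K K' \<omega>)"
    and K_star: "\<And>\<omega>. \<omega> \<in> space M \<Longrightarrow>
      is_arg_min (\<lambda>K. Max ((\<lambda>K'. P_bar K K' \<omega>) ` {1..V})) (\<lambda>K. K \<in> {1..V}) (K_star \<omega>)"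
  shows "(\<forall>\<Delta>>1. with_prob_at_least M (1 - \<delta> - \<epsilon>) (\<lambda>\<omega>.
           (1 - nu N \<sigma> V n \<Delta>) * excess_loss P \<gamma> (s_hat (K_star \<omega>) \<omega>) s_o
             \<le> (1 + 3 * nu N \<sigma> V n \<Delta>) * (INF K\<in>{1..V}. excess_loss P \<gamma> (s_hat K \<omega>) s_o)
               + remainder N \<alpha> \<sigma> V n \<Delta>)) \<and>
         (\<forall>\<Delta>>1. nu N \<sigma> V n \<Delta> \<le> 1 / 2 \<longrightarrow> with_prob_at_least M (1 - \<epsilon> - \<delta>) (\<lambda>\<omega>.
           excess_loss P \<gamma> (s_hat (K_star \<omega>) \<omega>) s_star
             \<le> excess_loss P \<gamma> s_o s_star
               + (1 + 8 * nu N \<sigma> V n \<Delta>) * (INF K\<in>{1..V}. excess_loss P \<gamma> (s_hat K \<omega>) s_o)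
               + 2 * remainder N \<alpha> \<sigma> V n \<Delta>))"
proof -
  interpret prob_space M by fact
  define I where "I = {1..V}"
  have finI: "finite I" and cardI: "card I = V" by (simp_all add: I_def)
  have V8: "8 \<le> V" using V by linarith
  have n: "2 * real V \<le> real n" using \<open>real V \<le> real n / 2\<close> by simp
  then have n0: "0 < real n" and n1: "1 \<in> {1..n}" using V8 by auto
  have V0: "0 < real V" using V8 by simp
  have rv: "random_variable P (X i)" if "i \<in> {1..n}" for i
    using indep that by (auto simp: indep_vars_def)
  have P: "prob_space P" using prob_space_distr[OF rv[OF n1]] ident[OF n1] by simp
  interpret P: prob_space P by (rule P)

  \<comment> \<open>The blocks as independent random variables\<close>
  have part: "disjoint_family_on B I" "(\<Union>K\<in>I. B K) = {1..n}"
    "\<And>K. K \<in> I \<Longrightarrow> B K \<noteq> {} \<and> \<bar>real (card (B K)) - real n / real V\<bar> \<le> 1"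
    using \<open>regular_partition n V B\<close> unfolding regular_partition_def I_def by auto
  have BK: "B K \<subseteq> {1..n}" "finite (B K)" "0 < card (B K)" if "K \<in> I" for K
  proof -
    show "B K \<subseteq> {1..n}" using part(2) that by auto
    then show "finite (B K)" by (rule finite_subset) simp
    then show "0 < card (B K)" using part(3)[OF that] by (simp add: card_gt_0_iff)
  qed
  have sum_card: "(\<Sum>K\<in>I. real (card (B K))) = real n"
  proof -
    have "card (\<Union>K\<in>I. B K) = (\<Sum>K\<in>I. card (B K))"
      using part(1) BK(2) finI by (intro card_UN_disjoint) (auto simp: disjoint_family_on_def)
    then show ?thesis unfolding part(2) by simp
  qed

  define Y where "Y K \<omega> = (\<lambda>i\<in>B K. X i \<omega>)" for K \<omega>
  define Q where "Q K = Pi\<^sub>M (B K) (\<lambda>_. P)" for K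
  have probQ: "prob_space (Q K)" for K unfolding Q_def by (intro prob_space_PiM P)
  have indepY: "indep_vars Q Y I"
    unfolding Q_def[abs_def] Y_def[abs_def] using BK(1) part(1) by (intro indep_vars_restrict[OF indep]) auto
  have lawY: "distr M (Q K) (Y K) = Q K" if K: "K \<in> I" for K
  proof -
    have "distr M (Pi\<^sub>M (B K) (\<lambda>_. P)) (\<lambda>\<omega>. \<lambda>i\<in>B K. X i \<omega>) = (\<Pi>\<^sub>M i\<in>B K. distr M P (X i))"
      using indep_vars_subset[OF indep BK(1)[OF K]] part(3)[OF K] BK(1)[OF K] rv
      by (subst (asm) indep_vars_iff_distr_eq_PiM') auto
    also have "\<dots> = Pi\<^sub>M (B K) (\<lambda>_. P)" using BK(1)[OF K] ident by (intro PiM_cong) auto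
    finally show ?thesis by (simp add: Q_def Y_def[abs_def])
  qed
  have Y_space: "Y K \<omega> \<in> space (Q K)" if "K \<in> I" "\<omega> \<in> space M" for K \<omega>
    using indepY that by (auto simp: indep_vars_def dest: measurable_space)
  have intS: "integrable P (\<gamma> t)" if "t \<in> S" for t using contrast \<open>S \<subseteq> T\<close> that by auto

  \<comment> \<open>The bad event and its probability\<close>
  \<comment> \<open>The square root of \<open>c\<close> is the number of standard deviations that a
    block mean may be off.\<close>
  define c where "c = L1\<^sup>2 * (real V / real n)"
  have c0: "0 < c" unfolding c_def using L1_pos V0 n0 by simp
  \<comment> \<open>\<open>Min D\<close> and \<open>Max D\<close> choose one orientation of the pair
    \<open>D\<close>.\<close>
  define f where "f D x z = \<gamma> (F (x (Min D))) z - \<gamma> (F (x (Max D))) z" for D and x :: "nat \<Rightarrow> nat \<Rightarrow> 'x" and z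
  define dev where "dev D J x y \<longleftrightarrow> block_deviates P c (B J) (f D x) y" for D J x y
  define p where "p J = 1 / (c * real (card (B J)))" for J
  have p0: "0 \<le> p J" for J unfolding p_def using c0 by simp
  have p_sum: "(\<Sum>J\<in>I. p J) \<le> 2 / 3 * r_const * real V"
  proof -
    have "p J = r_const * (real n / real V / (2 * real (card (B J))))" for J
      using r_const_pos by (simp add: p_def c_def L1_sqr)
    then have "(\<Sum>J\<in>I. p J) = r_const * (\<Sum>J\<in>I. real n / real V / (2 * real (card (B J))))"
      by (simp add: sum_distrib_left)
    also have "\<dots> \<le> r_const * (2 / 3 * real (card I))"
    proof (intro mult_left_mono sum_inverse_block_size_le)
      show "I \<noteq> {}" using V8 by (auto simp: I_def)
      show "2 \<le> real n / real V" using n V0 by (simp add: field_simps)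
      show "(\<Sum>J\<in>I. real (card (B J))) = real (card I) * (real n / real V)"
        using V0 by (simp add: sum_card cardI)
    qed (use finI BK(3) part(3) r_const_pos in auto)
    finally show ?thesis by (simp add: cardI mult_ac)
  qed

  \<comment> \<open>Half of the \<open>V - 2\<close> blocks outside a pair, rounded up: fewer than
    \<open>k\<close> deviating blocks are strictly fewer than half.\<close>
  define k where "k = (V - 1) div 2"
  define pairs where "pairs = {D. D \<subseteq> I \<and> card D = 2}"
  define subs where "subs D = {A. A \<subseteq> I - D \<and> card A = k}" for D
  define G where "G D A = {\<omega> \<in> space M. \<forall>J\<in>A. dev D J (\<lambda>K\<in>D. Y K \<omega>) (Y J \<omega>)}" for D A
  have fin: "finite pairs" "finite (subs D)" for D using finI by (auto simp: pairs_def subs_def)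
  have G: "G D A \<in> events" "prob (G D A) \<le> (\<Prod>J\<in>A. p J)" if D: "D \<in> pairs" and A: "A \<in> subs D" for D A
  proof -
    have DA: "finite D" "D \<noteq> {}" "D \<subseteq> I" "A \<subseteq> I" "D \<inter> A = {}" "finite A"
      using D A finI by (auto simp: pairs_def subs_def intro: finite_subset)
    then have mm: "Min D \<in> D" "Max D \<in> D" by auto
    have component: "(\<lambda>(x, z). \<gamma> (F (x K)) z) \<in> borel_measurable (Pi\<^sub>M D Q \<Otimes>\<^sub>M P)" if "K \<in> D" for K
    proof -
      have "(\<lambda>q. (fst q K, snd q)) \<in> measurable (Pi\<^sub>M D Q \<Otimes>\<^sub>M P) (Q K \<Otimes>\<^sub>M P)" using that by measurable
      from measurable_compose[OF this F_meas[of K, folded Q_def]] that DA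
      show ?thesis by (simp add: split_beta' I_def subset_eq)
    qed
    have "(\<lambda>(x, z). f D x z) \<in> borel_measurable (Pi\<^sub>M D Q \<Otimes>\<^sub>M P)"
      using component[OF mm(1)] component[OF mm(2)] unfolding f_def split_beta' by measurable
    then have meas: "Measurable.pred (Pi\<^sub>M D Q \<Otimes>\<^sub>M Q J) (\<lambda>(x, y). dev D J x y)" for J
      unfolding dev_def Q_def[of J] by (rule measurable_block_deviates[OF P])
    have le: "emeasure (Q J) {y \<in> space (Q J). dev D J x y} \<le> ennreal (p J)"
      if "J \<in> A" "x \<in> space (Pi\<^sub>M D Q)" for J x
    proof -
      have "F (x K) \<in> S" if "K \<in> D" for K
        using that \<open>x \<in> space _\<close> DA by (intro F_range[of K]) (auto simp: space_PiM Q_def I_def)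
      then have "integrable P (f D x)" unfolding f_def using mm intS by auto
      then show ?thesis unfolding dev_def p_def Q_def
        using BK[of J] that DA c0 by (intro emeasure_block_deviates_le P) auto
    qed
    \<comment> \<open>Fixing the blocks in \<open>D\<close> fixes both estimators, while the blocks
      in \<open>A\<close> stay independent with unchanged laws.\<close>
    note conditional = indep_vars_conditional_prob_le[where N = Q and Y = Y and Q = "dev D" and p = "\<lambda>J. ennreal (p J)",
        OF indepY lawY probQ DA(1,6,2,5) _ meas le]
    show "G D A \<in> events" unfolding G_def by (rule conditional) (use DA in auto)
    have "emeasure M (G D A) \<le> (\<Prod>J\<in>A. ennreal (p J))" unfolding G_def by (rule conditional) (use DA in auto)
    then show "prob (G D A) \<le> (\<Prod>J\<in>A. p J)"
      using p0 by (simp add: prod_ennreal emeasure_eq_measure prod_nonneg)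
  qed
  \<comment> \<open>The bad event is built from block deviations and not from the medians, whose
    choice may be non-measurable.\<close>
  define U where "U = (\<Union>D\<in>pairs. \<Union>A\<in>subs D. G D A)"
  have U_ev: "U \<in> events" unfolding U_def using fin G(1) by (intro sets.finite_UN) auto
  have "prob U \<le> \<delta>"
  proof -
    have "prob U \<le> (\<Sum>D\<in>pairs. prob (\<Union>A\<in>subs D. G D A))"
      unfolding U_def using fin G(1) by (intro finite_measure_subadditive_finite) (auto intro!: sets.finite_UN)
    also have "\<dots> \<le> (\<Sum>D\<in>pairs. \<Sum>A\<in>subs D. prob (G D A))"
      using fin G(1) by (intro sum_mono finite_measure_subadditive_finite) auto
    also have "\<dots> \<le> (\<Sum>D\<in>pairs. \<Sum>A\<in>subs D. \<Prod>J\<in>A. p J)"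
      using G(2) by (intro sum_mono) auto
    also have "\<dots> \<le> real ((card I - k) choose 2) * ((\<Sum>J\<in>I. p J) ^ k / fact k)"
      unfolding pairs_def subs_def using finI p0 by (intro sum_pairs_prod_subsets_le) auto
    also have "\<dots> \<le> real ((V - k) choose 2) * ((2 / 3 * r_const * real V) ^ k / fact k)"
      unfolding cardI using p_sum p0
      by (intro mult_left_mono divide_right_mono power_mono sum_nonneg) auto
    also have "\<dots> \<le> exp (- real V / 2)" using V8 by (intro union_bound_le) (auto simp: k_def)
    \<comment> \<open>This is what the choice of \<open>V\<close> is for: \<open>V\<close> is at
      least \<open>- 2 * ln \<delta>\<close>.\<close>
    also have "\<dots> \<le> \<delta>"
    proof -
      have "\<delta> powi (-2) = \<delta> powr (-2)" using \<open>\<delta> > 0\<close> by (simp add: power_int_def powr_minus power_inverse)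
      then have "ln (\<delta> powi (-2)) = -2 * ln \<delta>" using \<open>\<delta> > 0\<close> by (simp add: ln_powr)
      then have "-2 * ln \<delta> \<le> real_of_int (int V)" using V by linarith
      then have "exp (- real V / 2) \<le> exp (ln \<delta>)" by simp
      then show ?thesis using \<open>\<delta> > 0\<close> by simp
    qed
    finally show ?thesis .
  qed
  \<comment> \<open>The good event does not depend on \<Delta> and serves both claims.\<close>
  define E where "E = \<Omega>\<^sub>\<epsilon> - U"
  have E_ev: "E \<in> events" unfolding E_def using \<open>\<Omega>\<^sub>\<epsilon> \<in> sets M\<close> U_ev by auto
  have E_prob: "1 - \<delta> - \<epsilon> \<le> prob E"
  proof -
    have "prob E = prob \<Omega>\<^sub>\<epsilon> - prob (\<Omega>\<^sub>\<epsilon> \<inter> U)"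
      unfolding E_def using \<open>\<Omega>\<^sub>\<epsilon> \<in> sets M\<close> U_ev by (rule finite_measure_Diff')
    moreover have "prob (\<Omega>\<^sub>\<epsilon> \<inter> U) \<le> prob U" using U_ev by (intro finite_measure_mono) auto
    ultimately show ?thesis using \<open>prob U \<le> \<delta>\<close> \<open>measure M \<Omega>\<^sub>\<epsilon> \<ge> 1 - \<epsilon>\<close> by linarith
  qed
  have E_sub: "E \<subseteq> \<Omega>\<^sub>\<epsilon>" "E \<subseteq> space M"
    using sets.sets_into_space[OF E_ev] by (auto simp: E_def)

  \<comment> \<open>Deviations of the medians on the good event\<close>
  define l where "l K \<omega> = excess_loss P \<gamma> (s_hat K \<omega>) s_o" for K \<omega>
  \<comment> \<open>On \<open>E\<close> this bounds the standard deviation of the contrast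
    difference between \<open>s_hat K \<omega>\<close> and \<open>s_o\<close>.\<close>
  define w where "w K \<omega> = \<sigma> 0 * l K \<omega> + (\<Sum>i=1..N. \<sigma> i * rpow (l K \<omega>) (\<alpha> i))" for K \<omega>
  have so: "s_o \<in> S" and so_min: "\<And>t. t \<in> S \<Longrightarrow> (\<integral>x. \<gamma> s_o x \<partial>P) \<le> (\<integral>x. \<gamma> t x \<partial>P)"
    using best_in_S by (auto simp: is_arg_min_linorder)
  have sh: "s_hat K \<omega> = F (Y K \<omega>)" and shS: "s_hat K \<omega> \<in> S" if "K \<in> I" "\<omega> \<in> space M" for K \<omega>
  proof -
    show sh: "s_hat K \<omega> = F (Y K \<omega>)" using s_hat that by (simp add: Y_def I_def)
    show "s_hat K \<omega> \<in> S" unfolding sh using Y_space[OF that] that(1) by (intro F_range[of K]) (auto simp: Q_def I_def)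
  qed
  have l0: "0 \<le> l K \<omega>" if "K \<in> I" "\<omega> \<in> space M" for K \<omega>
    using so_min[OF shS[OF that]] intS[OF so] intS[OF shS[OF that]] by (simp add: l_def excess_loss_def)
  have l_diff: "(\<integral>x. \<gamma> (s_hat K \<omega>) x - \<gamma> (s_hat K' \<omega>) x \<partial>P) = l K \<omega> - l K' \<omega>"
    if "K \<in> I" "K' \<in> I" "\<omega> \<in> space M" for K K' \<omega>
    using intS[OF so] intS[OF shS] that by (simp add: l_def excess_loss_def)
  have w0: "0 \<le> w K \<omega>" if "K \<in> I" "\<omega> \<in> space M" for K \<omega>
    unfolding w_def using \<sigma> l0[OF that] by (intro add_nonneg_nonneg sum_nonneg mult_nonneg_nonneg rpow_nonneg) auto
  have var_le: "ext_variance P (\<lambda>x. \<gamma> (s_hat K \<omega>) x - \<gamma> s_o x) \<le> ennreal ((w K \<omega>)\<^sup>2)"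
    if K: "K \<in> I" and \<omega>: "\<omega> \<in> E" for K \<omega>
  proof -
    have \<omega>': "\<omega> \<in> space M" "\<omega> \<in> \<Omega>\<^sub>\<epsilon>" using \<omega> E_sub by auto
    have ll: "0 \<le> l K \<omega>" using l0 K \<omega>' by simp
    have "(\<sigma> 0)\<^sup>2 * (l K \<omega>)\<^sup>2 + (\<Sum>i=1..N. (\<sigma> i)\<^sup>2 * rpow (l K \<omega>) (2 * \<alpha> i))
        = (\<sigma> 0 * l K \<omega>)\<^sup>2 + (\<Sum>i=1..N. (\<sigma> i * rpow (l K \<omega>) (\<alpha> i))\<^sup>2)"
      using ll by (simp add: rpow_double power_mult_distrib)
    also have "\<dots> \<le> (\<sigma> 0 * l K \<omega>)\<^sup>2 + (\<Sum>i=1..N. \<sigma> i * rpow (l K \<omega>) (\<alpha> i))\<^sup>2"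
      using \<sigma> by (intro add_left_mono sum_sqr_le_sqr_sum mult_nonneg_nonneg rpow_nonneg) auto
    also have "\<dots> \<le> (w K \<omega>)\<^sup>2"
    proof -
      have "0 \<le> (\<sigma> 0 * l K \<omega>) * (\<Sum>i=1..N. \<sigma> i * rpow (l K \<omega>) (\<alpha> i))"
        using \<sigma> ll by (intro mult_nonneg_nonneg sum_nonneg rpow_nonneg) auto
      then show ?thesis unfolding w_def power2_sum by linarith
    qed
    finally have "ennreal ((\<sigma> 0)\<^sup>2 * (l K \<omega>)\<^sup>2 + (\<Sum>i=1..N. (\<sigma> i)\<^sup>2 * rpow (l K \<omega>) (2 * \<alpha> i)))
        \<le> ennreal ((w K \<omega>)\<^sup>2)" by (rule ennreal_leI)
    then show ?thesis
      using margin[OF \<omega>'(2), of K] K unfolding l_def I_def by (blast intro: order_trans)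
  qed
  have median_dev: "\<bar>P_bar K K' \<omega> - (l K \<omega> - l K' \<omega>)\<bar> \<le> L1 * sqrt (real V / real n) * (w K \<omega> + w K' \<omega>)"
    if K: "K \<in> I" "K' \<in> I" and \<omega>: "\<omega> \<in> E" for K K' \<omega>
  proof -
    have \<omega>': "\<omega> \<in> space M" "\<omega> \<notin> U" using \<omega> E_sub by (auto simp: E_def)
    let ?t = "L1 * sqrt (real V / real n) * (w K \<omega> + w K' \<omega>)"
    let ?g = "\<lambda>x. \<gamma> (s_hat K \<omega>) x - \<gamma> (s_hat K' \<omega>) x"
    let ?a = "\<lambda>J. block_mean (\<lambda>i. X i \<omega>) (B J) ?g"
    have t0: "0 \<le> ?t" using w0[OF K(1) \<omega>'(1)] w0[OF K(2) \<omega>'(1)] L1_pos by simp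
    have var: "ext_variance P ?g \<le> ennreal ((w K \<omega> + w K' \<omega>)\<^sup>2)"
    proof -
      \<comment> \<open>Inserting \<open>s_o\<close> splits the difference into two parts, each
        controlled by the margin condition.\<close>
      have "ext_variance P (\<lambda>x. (\<gamma> (s_hat K \<omega>) x - \<gamma> s_o x) - (\<gamma> (s_hat K' \<omega>) x - \<gamma> s_o x))
          \<le> ennreal ((w K \<omega> + w K' \<omega>)\<^sup>2)"
        using K \<omega> \<omega>' w0 var_le intS so shS by (intro ext_variance_minus_le) auto
      then show ?thesis by simp
    qed
    \<comment> \<open>The threshold is chosen so that its square is \<open>c\<close> times the
      variance bound just obtained.\<close>
    have dev_Y: "block_deviates P c (B J) ?g (Y J \<omega>)" if "?t < \<bar>?a J - (l K \<omega> - l K' \<omega>)\<bar>" for J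
    proof -
      have "ennreal c * ext_variance P ?g \<le> ennreal c * ennreal ((w K \<omega> + w K' \<omega>)\<^sup>2)"
        using var by (intro mult_left_mono) auto
      also have "\<dots> = ennreal (?t\<^sup>2)"
        using c0 by (simp add: ennreal_mult[symmetric] c_def power_mult_distrib)
      also have "\<dots> < ennreal ((?a J - (l K \<omega> - l K' \<omega>))\<^sup>2)"
        using t0 that power_strict_mono[OF that t0, of 2] by (intro ennreal_lessI) (auto intro: le_less_trans[OF zero_le_power2])
      also have "?a J = block_mean (Y J \<omega>) (B J) ?g"
        by (simp add: block_mean_def Y_def)
      finally show ?thesis unfolding block_deviates_def l_diff[OF K \<omega>'(1)] .
    qed
    define C where "C = {J \<in> I - {K, K'}. ?t < \<bar>?a J - (l K \<omega> - l K' \<omega>)\<bar>}"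
    have few: "real (card C) < real (card (I - {K, K'})) / 2"
    \<comment> \<open>For equal indices the contrast difference is zero, and no block deviates; the
      bad event covers only pairs of distinct indices.\<close>
    proof (cases "K = K'")
      case True
      then have "C = {}"
        using t0 by (auto simp: C_def block_mean_def)
      moreover have "0 < card (I - {K, K'})" using True K finI cardI V8 by simp
      ultimately show ?thesis by simp
    next
      case False
      define D where "D = {K, K'}"
      have D: "D \<in> pairs" using False K by (simp add: pairs_def D_def)
      have f_D: "f D (\<lambda>K\<in>D. Y K \<omega>) = ?g \<or> f D (\<lambda>K\<in>D. Y K \<omega>) = (\<lambda>x. \<gamma> (s_hat K' \<omega>) x - \<gamma> (s_hat K \<omega>) x)"
        using False sh[OF K(1) \<omega>'(1)] sh[OF K(2) \<omega>'(1)]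
        by (cases "K < K'") (auto simp: f_def D_def fun_eq_iff)
      have dev_D: "dev D J (\<lambda>K\<in>D. Y K \<omega>) (Y J \<omega>)" if "?t < \<bar>?a J - (l K \<omega> - l K' \<omega>)\<bar>" for J
        using f_D dev_Y[OF that] unfolding dev_def
        by (auto simp: block_deviates_minus_commute[of P c "B J" "\<gamma> (s_hat K' \<omega>)" "\<gamma> (s_hat K \<omega>)"])
      have "card C < k"
      proof (rule ccontr)
        assume "\<not> card C < k"
        \<comment> \<open>Any \<open>k\<close> of the deviating blocks would put \<omega> into one
          of the events \<open>G D A\<close>.\<close>
        then obtain A where A: "A \<subseteq> C" "card A = k" by (meson not_less obtain_subset_with_card_n)
        then have "A \<in> subs D" by (auto simp: subs_def C_def D_def)
        moreover have "\<omega> \<in> G D A" using A(1) dev_D \<omega>'(1) by (auto simp: G_def C_def)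
        ultimately show False using D \<omega>'(2) by (auto simp: U_def)
      qed
      moreover have "card (I - {K, K'}) = V - 2"
        using False K finI cardI by (simp add: card_Diff_subset)
      ultimately show ?thesis unfolding k_def using V8 by linarith
    qed
    from median_close[OF _ P_bar[OF \<omega>'(1), of K K', folded I_def] few[unfolded C_def]] K finI show ?thesis by simp
  qed

  \<comment> \<open>The two oracle inequalities\<close>
  have nu0: "0 \<le> nu N \<sigma> V n \<Delta>" and R0: "0 \<le> remainder N \<alpha> \<sigma> V n \<Delta>" if "1 < \<Delta>" for \<Delta>
  proof -
    show "0 \<le> nu N \<sigma> V n \<Delta>" unfolding nu_def using that \<sigma>[of 0] L1_pos by simp
    show "0 \<le> remainder N \<alpha> \<sigma> V n \<Delta>" unfolding remainder_def C_const_def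
      using \<alpha> by (intro sum_nonneg mult_nonneg_nonneg) (auto intro: less_imp_le)
  qed
  have selected: "(1 - nu N \<sigma> V n \<Delta>) * l (K_star \<omega>) \<omega>
      \<le> (1 + 3 * nu N \<sigma> V n \<Delta>) * (INF K\<in>I. l K \<omega>) + remainder N \<alpha> \<sigma> V n \<Delta>"
    if \<Delta>: "1 < \<Delta>" and \<omega>: "\<omega> \<in> E" for \<Delta> \<omega>
  proof (rule selection_excess_le[where p = "\<lambda>K K'. P_bar K K' \<omega>"])
    have \<omega>': "\<omega> \<in> space M" using \<omega> E_sub by auto
    show "0 \<le> l K \<omega>" if "K \<in> I" for K using l0 that \<omega>' by simp
    show "is_arg_min (\<lambda>K. Max ((\<lambda>K'. P_bar K K' \<omega>) ` I)) (\<lambda>K. K \<in> I) (K_star \<omega>)"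
      using K_star[OF \<omega>'] by (simp add: I_def)
    fix K K' assume K: "K \<in> I" "K' \<in> I"
    have *: "L1 * sqrt (real V / real n) * w J \<omega> \<le> nu N \<sigma> V n \<Delta> * l J \<omega> + remainder N \<alpha> \<sigma> V n \<Delta> / 4"
      if "J \<in> I" for J
      unfolding w_def using \<alpha> \<sigma> \<Delta> l0[OF that \<omega>'] by (intro std_dev_bound_le) auto
    show "\<bar>P_bar K K' \<omega> - (l K \<omega> - l K' \<omega>)\<bar>
        \<le> nu N \<sigma> V n \<Delta> * (l K \<omega> + l K' \<omega>) + remainder N \<alpha> \<sigma> V n \<Delta> / 2"
      using median_dev[OF K \<omega>] *[OF K(1)] *[OF K(2)] by (simp only: distrib_left)
  qed (use finI nu0[OF \<Delta>] R0[OF \<Delta>] in auto)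

  show ?thesis
  proof (intro conjI allI impI)
    fix \<Delta> :: real assume \<Delta>: "1 < \<Delta>"
    show "with_prob_at_least M (1 - \<delta> - \<epsilon>) (\<lambda>\<omega>.
           (1 - nu N \<sigma> V n \<Delta>) * excess_loss P \<gamma> (s_hat (K_star \<omega>) \<omega>) s_o
             \<le> (1 + 3 * nu N \<sigma> V n \<Delta>) * (INF K\<in>{1..V}. excess_loss P \<gamma> (s_hat K \<omega>) s_o)
               + remainder N \<alpha> \<sigma> V n \<Delta>)"
      unfolding with_prob_at_least_def using E_ev E_prob selected[OF \<Delta>, unfolded l_def I_def] by blast
    assume nu: "nu N \<sigma> V n \<Delta> \<le> 1 / 2"
    have "excess_loss P \<gamma> (s_hat (K_star \<omega>) \<omega>) s_star
             \<le> excess_loss P \<gamma> s_o s_star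
               + (1 + 8 * nu N \<sigma> V n \<Delta>) * (INF K\<in>{1..V}. excess_loss P \<gamma> (s_hat K \<omega>) s_o)
               + 2 * remainder N \<alpha> \<sigma> V n \<Delta>" if \<omega>: "\<omega> \<in> E" for \<omega>
    proof -
      have \<omega>': "\<omega> \<in> space M" using \<omega> E_sub by auto
      have Ks: "K_star \<omega> \<in> I" using K_star[OF \<omega>'] by (simp add: is_arg_min_def I_def)
      have "s_star \<in> T" using target by (simp add: is_arg_min_def)
      \<comment> \<open>The excess loss is additive along \<open>s_o\<close>, so only the part
        relative to \<open>s_o\<close> remains to be bounded.\<close>
      then have split: "excess_loss P \<gamma> (s_hat (K_star \<omega>) \<omega>) s_star
          = excess_loss P \<gamma> s_o s_star + l (K_star \<omega>) \<omega>"
        using intS[OF so] intS[OF shS[OF Ks \<omega>']] contrast by (simp add: l_def excess_loss_def)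
      have "0 \<le> (INF K\<in>I. l K \<omega>)" using Ks l0 \<omega>' by (intro cINF_greatest) auto
      from excess_le_of_half[OF selected[OF \<Delta> \<omega>] nu0[OF \<Delta>] nu this R0[OF \<Delta>]]
      show ?thesis unfolding split unfolding l_def I_def by simp
    qed
    then show "with_prob_at_least M (1 - \<epsilon> - \<delta>) (\<lambda>\<omega>.
           excess_loss P \<gamma> (s_hat (K_star \<omega>) \<omega>) s_star
             \<le> excess_loss P \<gamma> s_o s_star
               + (1 + 8 * nu N \<sigma> V n \<Delta>) * (INF K\<in>{1..V}. excess_loss P \<gamma> (s_hat K \<omega>) s_o)
               + 2 * remainder N \<alpha> \<sigma> V n \<Delta>)"
      unfolding with_prob_at_least_def using E_ev E_prob by (intro bexI[of _ E]) auto
  qed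
qed

end
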